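(* Let $n=2k$ be even and let $(F_1,F_2)$ be an oriented transverse pair in $\mathrm{Flag}^+(\mathbb{R}^n)$. Then $$\mathcal{H}(F_1,F_2)=\bigcup_{F\in(\!(F_1,F_2)\!)}\mathbb{P}F^{(k)}.$$
   Context: Oriented flags ($n=2k$). $\mathbb{R}^n$ has its standard orientation. Consider complete flags $F^{(1)}\subset\dots\subset F^{(n-1)}$ in $\mathbb{R}^n$ ($\dim F^{(i)}=i$) with a choice of orientation on each $F^{(i)}$. As $n$ is even, $\mathrm{Flag}^+(\mathbb{R}^n)$ is the quotient of the set of these by simultaneously reversing the orientations of all odd-dimensional $F^{(i)}$; an oriented flag before passing to this quotient is called a lift. Direct sums of oriented subspaces are oriented by concatenating positive bases in order; $F^{(0)}=\{0\}$. A triple $(F_1,F_2,F_3)$ is hyperconvex if there are lifts with $\widehat F_1^{(i_1)}\oplus \widehat F_2^{(i_2)}\oplus \widehat F_3^{(i_3)}=\mathbb{R}^n$ as oriented vector spaces for all integers $0\le i_1,i_2,i_3\le n-1$ with $i_1+i_2+i_3=n$. The interval is $(\!(F_1,F_2)\!)=\{F:(F_1,F,F_2)\text{ hyperconvex}\}$. A pair $(F_1,F_2)$ is oriented transverse if there are lifts with $\widehat F_1^{(i)}\oplus\widehat F_2^{(n-i)}=\mathbb{R}^n$ as oriented spaces for $1\le i\le n-1$. For an oriented transverse pair there is a positively oriented ordered basis $\mathcal{E}=(e_1,\dots,e_n)$ of $\mathbb{R}^n$, unique up to positive scaling of the basis vectors (and global sign), such that $F_1$ is the class of the oriented flag with $i$-th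 space $\mathrm{span}(e_1,\dots,e_i)$ and $F_2$ the class of the oriented flag with $i$-th space $\mathrm{span}(e_{n-i+1},\dots,e_n)$, each span oriented by the listed order; $\mathcal{E}$ is called adapted to $(F_1,F_2)$. Halfspaces. For $v\neq 0$, $S^+_{\mathcal{E}}(v)$ is the maximal number of sign changes in the sequence of coordinates of $v$ in the basis $\mathcal{E}$, over all ways of assigning signs to zero coordinates. For an oriented transverse pair with adapted basis $\mathcal{E}$, the open halfspace is $\mathcal{H}(F_1,F_2)=\{[v]\in\mathbb{RP}^{n-1}: S^+_{\mathcal{E}}(v)\le k-1\}$. $\mathbb{P}F^{(k)}\subset\mathbb{RP}^{n-1}$ is the projectivization of the underlying subspace $F^{(k)}$. *)

theory Defs
  imports
    Jordan_Normal_Form.Matrix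
    Jordan_Normal_Form.Determinant
    Jordan_Normal_Form.VS_Connect
begin

text \<open>Linear algebra in \<open>\<real>\<^sup>n\<close>, modelled by \<^term>\<open>carrier_vec n :: real vec set\<close>.\<close>

abbreviation rspan :: "nat \<Rightarrow> real vec set \<Rightarrow> real vec set" where
  "rspan n \<equiv> LinearCombinations.module.span class_ring (module_vec TYPE(real) n)"

abbreviation rlin_indpt :: "nat \<Rightarrow> real vec set \<Rightarrow> bool" where
  "rlin_indpt n \<equiv> LinearCombinations.module.lin_indpt class_ring (module_vec TYPE(real) n)"

definition lin_indpt_list :: "nat \<Rightarrow> real vec list \<Rightarrow> bool" where
  "lin_indpt_list n bs \<longleftrightarrow> set bs \<subseteq> carrier_vec n \<and> distinct bs \<and> rlin_indpt n (set bs)"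

text \<open>
  The tuple \<open>cs\<close> is obtained from \<open>bs\<close> by the square matrix \<open>A\<close>:
  \<open>cs ! j = (\<Sum>i. A $$ (i, j) \<cdot> bs ! i)\<close>.
\<close>

definition base_change :: "nat \<Rightarrow> real mat \<Rightarrow> real vec list \<Rightarrow> real vec list \<Rightarrow> bool" where
  "base_change n A bs cs \<longleftrightarrow>
     A \<in> carrier_mat (length bs) (length bs) \<and> length cs = length bs \<and>
     set cs \<subseteq> carrier_vec n \<and> mat_of_cols n cs = mat_of_cols n bs * A"

text \<open>
  An oriented subspace is represented by the set of its positively oriented ordered bases.
  The zero space has a single ordered basis, the empty list, hence only its positive orientation
  \<open>{[]}\<close> is represented.
\<close>

definition orientation_class :: "nat \<Rightarrow> real vec list \<Rightarrow> real vec list set" where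
  "orientation_class n bs = {cs. \<exists>A. base_change n A bs cs \<and> det A > 0}"

definition oriented_subspaces :: "nat \<Rightarrow> nat \<Rightarrow> real vec list set set" where
  "oriented_subspaces n d =
     {orientation_class n bs | bs. lin_indpt_list n bs \<and> length bs = d}"

definition underlying_subspace :: "nat \<Rightarrow> real vec list set \<Rightarrow> real vec set" where
  "underlying_subspace n U = rspan n (\<Union>bs\<in>U. set bs)"

definition reverse_orientation :: "nat \<Rightarrow> real vec list set \<Rightarrow> real vec list set" where
  "reverse_orientation n U = {cs. \<exists>bs\<in>U. \<exists>A. base_change n A bs cs \<and> det A < 0}"

definition standard_orientation :: "nat \<Rightarrow> real vec list set" where
  "standard_orientation n = orientation_class n (unit_vecs n)"

text \<open>
  The oriented sum. If the underlying subspaces are not in direct sum, its members are linearly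
  dependent; so an equation \<open>oriented_sum n U V = standard_orientation n\<close> includes the claim that
  \<open>\<real>\<^sup>n\<close> is the direct sum of the underlying subspaces.
\<close>

definition oriented_sum ::
    "nat \<Rightarrow> real vec list set \<Rightarrow> real vec list set \<Rightarrow> real vec list set" where
  "oriented_sum n U V = (\<Union>bs\<in>U. \<Union>cs\<in>V. orientation_class n (bs @ cs))"

text \<open>
  A lift is the sequence of its oriented subspaces of dimension \<open>0, \<dots>, n - 1\<close>. The
  value \<open>{}\<close> beyond this range is a mere convention, making equality of lifts extensional.
\<close>

type_synonym flag_lift = "nat \<Rightarrow> real vec list set"

definition flag_lifts :: "nat \<Rightarrow> flag_lift set" where
  "flag_lifts n =
     {f. (\<forall>i<n. f i \<in> oriented_subspaces n i) \<and> (\<forall>i\<ge>n. f i = {}) \<and>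
         (\<forall>i. Suc i < n \<longrightarrow> underlying_subspace n (f i) \<subseteq> underlying_subspace n (f (Suc i)))}"

definition reverse_odd :: "nat \<Rightarrow> flag_lift \<Rightarrow> flag_lift" where
  "reverse_odd n f = (\<lambda>i. if odd i then reverse_orientation n (f i) else f i)"

definition lift_rel :: "nat \<Rightarrow> (flag_lift \<times> flag_lift) set" where
  "lift_rel n = {(f, g). f \<in> flag_lifts n \<and> g \<in> flag_lifts n \<and> (g = f \<or> g = reverse_odd n f)}"

text \<open>An element of \<open>Flag\<^sup>+(\<real>\<^sup>n)\<close> is the set of its lifts.\<close>

type_synonym oriented_flag = "flag_lift set"

definition Flag_plus :: "nat \<Rightarrow> oriented_flag set" where
  "Flag_plus n = flag_lifts n // lift_rel n"

definition hyperconvex :: "nat \<Rightarrow> oriented_flag \<Rightarrow> oriented_flag \<Rightarrow> oriented_flag \<Rightarrow> bool" where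
  "hyperconvex n F1 F2 F3 \<longleftrightarrow>
     (\<exists>f1\<in>F1. \<exists>f2\<in>F2. \<exists>f3\<in>F3. \<forall>i1<n. \<forall>i2<n. \<forall>i3<n. i1 + i2 + i3 = n \<longrightarrow>
        oriented_sum n (oriented_sum n (f1 i1) (f2 i2)) (f3 i3) = standard_orientation n)"

definition flag_interval :: "nat \<Rightarrow> oriented_flag \<Rightarrow> oriented_flag \<Rightarrow> oriented_flag set" where
  "flag_interval n F1 F2 = {F \<in> Flag_plus n. hyperconvex n F1 F F2}"

definition oriented_transverse :: "nat \<Rightarrow> oriented_flag \<Rightarrow> oriented_flag \<Rightarrow> bool" where
  "oriented_transverse n F1 F2 \<longleftrightarrow>
     (\<exists>f1\<in>F1. \<exists>f2\<in>F2. \<forall>i. 1 \<le> i \<and> i < n \<longrightarrow>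
        oriented_sum n (f1 i) (f2 (n - i)) = standard_orientation n)"

definition initial_lift :: "nat \<Rightarrow> real vec list \<Rightarrow> flag_lift" where
  "initial_lift n E = (\<lambda>i. if i < n then orientation_class n (take i E) else {})"

definition final_lift :: "nat \<Rightarrow> real vec list \<Rightarrow> flag_lift" where
  "final_lift n E = (\<lambda>i. if i < n then orientation_class n (drop (n - i) E) else {})"

definition adapted_basis ::
    "nat \<Rightarrow> oriented_flag \<Rightarrow> oriented_flag \<Rightarrow> real vec list \<Rightarrow> bool" where
  "adapted_basis n F1 F2 E \<longleftrightarrow>
     E \<in> standard_orientation n \<and>
     F1 = lift_rel n `` {initial_lift n E} \<and> F2 = lift_rel n `` {final_lift n E}"

definition coordinates :: "nat \<Rightarrow> real vec list \<Rightarrow> real vec \<Rightarrow> real vec" where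
  "coordinates n E v = (THE c. c \<in> carrier_vec n \<and> mat_of_cols n E *\<^sub>v c = v)"

definition sign_assignments :: "real vec \<Rightarrow> real list set" where
  "sign_assignments c =
     {s. length s = dim_vec c \<and>
         (\<forall>i<dim_vec c. if c $ i = 0 then s ! i \<in> {1, -1} else s ! i = sgn (c $ i))}"

definition sign_changes :: "real list \<Rightarrow> nat" where
  "sign_changes s = card {i. Suc i < length s \<and> s ! i \<noteq> s ! Suc i}"

definition S_plus :: "nat \<Rightarrow> real vec list \<Rightarrow> real vec \<Rightarrow> nat" where
  "S_plus n E v = Max (sign_changes ` sign_assignments (coordinates n E v))"

text \<open>A point of real projective space is a line through the origin.\<close>

definition proj_point :: "real vec \<Rightarrow> real vec set" where
  "proj_point v = {c \<cdot>\<^sub>v v | c. True}"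

definition projectivization :: "nat \<Rightarrow> real vec set \<Rightarrow> real vec set set" where
  "projectivization n W = {proj_point v | v. v \<in> W \<and> v \<noteq> 0\<^sub>v n}"

text \<open>
  Adapted bases differ by positive scalings and a global sign, neither of which affects
  \<^const>\<open>S_plus\<close>; hence the choice of the adapted basis is immaterial.
\<close>

definition halfspace :: "nat \<Rightarrow> oriented_flag \<Rightarrow> oriented_flag \<Rightarrow> real vec set set" where
  "halfspace n F1 F2 =
     {proj_point v | v. v \<in> carrier_vec n \<and> v \<noteq> 0\<^sub>v n \<and>
        (\<exists>E. adapted_basis n F1 F2 E \<and> S_plus n E v \<le> n div 2 - 1)}"

text \<open>The lifts of an oriented flag all have the same underlying subspaces.\<close>

definition flag_subspace :: "nat \<Rightarrow> oriented_flag \<Rightarrow> nat \<Rightarrow> real vec set" where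
  "flag_subspace n F i = (\<Union>f\<in>F. underlying_subspace n (f i))"

end

theory Submission
  imports Defs "Jordan_Normal_Form.DL_Rank"
begin

text \<open>
  Let \<open>E = (e\<^sub>1, \<dots>, e\<^sub>n)\<close> be a basis adapted to \<open>(F\<^sub>1, F\<^sub>2)\<close>, and let a lift of \<open>F\<close> have as
  its \<open>i\<close>-th space the span of \<open>b\<^sub>1, \<dots>, b\<^sub>i\<close>. In the coordinates given by \<open>E\<close>, the oriented
  sum \<open>\<langle>e\<^sub>1, \<dots>, e\<^sub>a\<rangle> \<oplus> \<langle>b\<^sub>1, \<dots>, b\<^sub>m\<rangle> \<oplus> \<langle>e\<^sub>a\<^sub>+\<^sub>m\<^sub>+\<^sub>1, \<dots>, e\<^sub>n\<rangle>\<close> is governed by the sign of the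
  minor with the first \<open>m\<close> columns and the \<open>m\<close> consecutive rows after row \<open>a\<close> of the matrix
  with columns \<open>b\<^sub>j\<close> (\<open>det_frame_minor\<close>). So \<open>F\<close> lies in the interval if and only if, for
  suitable lifts, all these minors are positive. They are discrete Wronskians, and the theorem
  becomes a discrete version of a classical fact about systems of functions with positive
  Wronskians, for sequences \<open>u\<close> with \<open>n\<close> terms and \<open>0 < k < n\<close>: \<open>S\<^sup>+(u) \<le> k - 1\<close> if and only
  if \<open>u\<close> is a nonzero combination of the first \<open>k\<close> columns of some matrix with positive minors
  as above.

  Both directions rest on one reduction: dividing all columns by the first one and taking
  differences of consecutive rows turns a positive system into a positive system with one
  column and one row fewer, and conversely (\<open>positive_system_reduced_iff\<close>). Under it, a
  combination of \<open>k\<close> columns becomes one of \<open>k - 1\<close> columns. By a discrete Rolle theorem,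
  differencing lowers \<open>S\<^sup>+\<close> by at most one, so by induction a nonzero combination of \<open>k\<close>
  columns has \<open>S\<^sup>+ \<le> k - 1\<close> (\<open>alternations_combination_le\<close>). In the other direction, positive
  weights can be chosen such that differencing the weighted sequence does lower \<open>S\<^sup>+\<close>, as long
  as the sequence is not of one strict sign (\<open>rescaling_decreases_alternations\<close>). The inverses
  of the weights serve as the first column, and the rest of the system is obtained by
  summation from a system for the shorter sequence (\<open>positive_system_through_vector\<close>).

  What remains is to translate between lifts and bases. Every lift comes from an ordered basis
  of the whole space, and two lifts that are transverse in the oriented sense come from the
  initial and the final segments of one common basis (\<open>adapted_basis_exists\<close>).
\<close>

section \<open>Sign changes and weak alternations\<close>

text \<open>
  Reading \<open>xs\<close> from left to right, this picks an entry as soon as it is weakly of the sign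
  opposite to the last one (initially \<open>\<sigma>\<close>). Greedy choice is optimal, so the result is the
  length of a longest subsequence with weak signs \<open>- \<sigma>, \<sigma>, - \<sigma>, \<dots>\<close>. The larger of the values
  at \<open>\<sigma> = 1\<close> and \<open>\<sigma> = - 1\<close> exceeds the maximal number \<open>S\<^sup>+\<close> of sign changes by one, for a
  nonempty list. The recursive form is what makes the inductions below short; keeping both
  signs \<open>\<sigma>\<close> in the statements makes their hypotheses strong enough.
\<close>
fun alternations :: "real \<Rightarrow> real list \<Rightarrow> nat" where
  "alternations \<sigma> [] = 0"
| "alternations \<sigma> (x # xs) =
     (if \<sigma> * x \<le> 0 then Suc (alternations (- \<sigma>) xs) else alternations \<sigma> xs)"

fun differences :: "real list \<Rightarrow> real list" where
  "differences (x # y # xs) = (y - x) # differences (y # xs)"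
| "differences xs = []"

text \<open>
  Dropping the first entry of an alternating subsequence leaves one that starts with the other
  sign.
\<close>
lemma alternations_uminus_le: "alternations \<sigma> xs \<le> Suc (alternations (- \<sigma>) xs)"
proof (induction xs arbitrary: \<sigma>)
  case (Cons x xs)
  show ?case using Cons.IH[of \<sigma>] Cons.IH[of "- \<sigma>"] by auto
qed simp

lemma alternations_cong_sgn:
  "map sgn xs = map sgn ys \<Longrightarrow> alternations \<sigma> xs = alternations \<sigma> ys"
proof (induction xs arbitrary: ys \<sigma>)
  case (Cons x xs)
  then obtain y ys' where ys: "ys = y # ys'" and s: "sgn x = sgn y"
    and m: "map sgn xs = map sgn ys'" by (cases ys) auto
  have "\<sigma> * x \<le> 0 \<longleftrightarrow> \<sigma> * y \<le> 0"
    using s by (auto simp: mult_le_0_iff sgn_if split: if_splits)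
  then show ?case using Cons.IH[OF m] ys by simp
qed simp

lemma alternations_one_sign:
  assumes "\<forall>x\<in>set xs. 0 < \<rho> * x"
  shows "0 < \<sigma> * \<rho> \<Longrightarrow> alternations \<sigma> xs = 0"
    and "\<sigma> * \<rho> < 0 \<Longrightarrow> xs \<noteq> [] \<Longrightarrow> alternations \<sigma> xs = 1"
proof -
  have *: "alternations \<sigma> xs = 0" if "0 < \<sigma> * \<rho>" "\<forall>x\<in>set xs. 0 < \<rho> * x" for \<sigma> xs
    using that
  proof (induction xs)
    case (Cons x xs)
    have "0 < \<sigma> * x" using Cons.prems by (auto simp: zero_less_mult_iff)
    then show ?case using Cons by simp
  qed simp
  show "0 < \<sigma> * \<rho> \<Longrightarrow> alternations \<sigma> xs = 0" using * assms by blast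
  show "alternations \<sigma> xs = 1" if s: "\<sigma> * \<rho> < 0" and "xs \<noteq> []"
  proof -
    obtain x ys where xs: "xs = x # ys" using \<open>xs \<noteq> []\<close> by (cases xs) auto
    have "\<sigma> * x \<le> 0" using assms s xs
      by (auto simp: zero_less_mult_iff mult_less_0_iff mult_le_0_iff)
    moreover have "alternations (- \<sigma>) ys = 0" using s assms xs by (intro *) auto
    ultimately show ?thesis using xs by simp
  qed
qed

lemma alternations_le_length: "alternations \<sigma> xs \<le> length xs"
  by (induction \<sigma> xs rule: alternations.induct) auto

lemma alternations_pos: "xs \<noteq> [] \<Longrightarrow> 0 < alternations \<sigma> xs \<or> 0 < alternations (- \<sigma>) xs"
  by (cases xs) auto

text \<open>
  A discrete Rolle theorem: between two entries of weakly opposite signs, some difference has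
  weakly the sign of the passage from the first to the second.
\<close>
lemma alternations_le_differences: 
  "alternations (- \<sigma>) xs \<le> Suc (alternations \<sigma> (differences xs))"
proof (induction xs arbitrary: \<sigma> rule: differences.induct)
  case (1 x y r)
  let ?d = "alternations \<sigma> (differences (y # r))" and ?d' = "alternations (- \<sigma>) (differences (y # r))"
  have IH: "alternations (- \<sigma>) (y # r) \<le> Suc ?d" "alternations \<sigma> (y # r) \<le> Suc ?d'"
    using 1[of \<sigma>] 1[of "- \<sigma>"] by simp_all
  consider "\<sigma> * x \<ge> 0" "\<sigma> * (y - x) \<le> 0" | "\<sigma> * x \<ge> 0" "\<sigma> * (y - x) > 0"
    | "\<sigma> * x < 0" "\<sigma> * (y - x) > 0" | "\<sigma> * x < 0" "\<sigma> * (y - x) \<le> 0" by linarith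
  then show ?case
  proof cases
    case 1
    then show ?thesis using IH(2) by simp
  next
    case 2
    then have "\<sigma> * y > 0" by (simp add: algebra_simps)
    then show ?thesis using 2 IH(1) by simp
  next
    case 3
    then show ?thesis using IH(1) by simp
  next
    case 4
    then show ?thesis using IH(1) alternations_uminus_le[of \<sigma> "differences (y # r)"] by simp
  qed
qed auto

lemma increasing_rescaling:
  assumes "\<forall>x\<in>set xs. 0 < \<rho> * x"
  shows "\<exists>ys. map sgn ys = map sgn xs \<and> (\<forall>d\<in>set (differences ys). 0 < \<rho> * d)"
  using assms
proof (induction xs)
  case (Cons x xs)
  then obtain ys where ys: "map sgn ys = map sgn xs" "\<forall>d\<in>set (differences ys). 0 < \<rho> * d" by auto
  show ?case
  proof (cases ys)
    case Nil
    then show ?thesis using ys by (intro exI[of _ "[x]"]) auto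
  next
    case (Cons y zs)
    with ys obtain x' xs' where xs: "xs = x' # xs'" "sgn y = sgn x'" by (cases xs) auto
    have "0 < \<rho> * x'" "0 < \<rho> * x" using Cons.prems xs by auto
    with xs have "0 < \<rho> * y" "sgn (y / 2) = sgn x"
      by (auto simp: zero_less_mult_iff sgn_if split: if_splits)
    then have "map sgn (y / 2 # ys) = map sgn (x # xs)"
      and "\<forall>d\<in>set (differences (y / 2 # ys)). 0 < \<rho> * d"
      using ys Cons by auto
    then show ?thesis by blast
  qed
qed auto

text \<open>
  A converse of Rolle's theorem: changing the absolute values of the entries, one can reach
  the extreme case in which taking differences does lose an alternation. The list is built
  from its end. A new first entry \<open>x\<close> gets so large an absolute value that the first
  difference has the sign opposite to \<open>x\<close>; then both recursions branch in the same way. The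
  only other case is a tail of one strict sign, where no alternation can be lost in the tail
  and all differences are made of that sign instead.
\<close>
lemma rescaling_decreases_alternations:
  assumes "\<not> (\<exists>\<rho>. \<forall>x\<in>set xs. 0 < \<rho> * x)"
  shows "\<exists>ys. map sgn ys = map sgn xs \<and>
    (\<forall>\<sigma>. \<sigma> \<noteq> 0 \<longrightarrow> Suc (alternations \<sigma> (differences ys)) \<le> alternations (- \<sigma>) xs)"
  using assms
proof (induction xs)
  case (Cons x xs)
  show ?case
  proof (cases "\<exists>\<rho>. \<forall>x\<in>set xs. 0 < \<rho> * x")
    case True
    then obtain \<rho> where \<rho>: "\<forall>x\<in>set xs. 0 < \<rho> * x" by blast
    show ?thesis
    proof (cases "xs = []")
      case True
      then have "x = 0" using Cons.prems
        by (metis empty_iff empty_set not_real_square_gt_zero set_ConsD)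
      then show ?thesis using True by (intro exI[of _ "[0]"]) auto
    next
      case False
      then obtain x' xs' where xs: "xs = x' # xs'" by (cases xs) auto
      have x: "\<rho> * x \<le> 0" using Cons.prems \<rho> by (metis linorder_not_le set_ConsD)
      obtain ys where ys: "map sgn ys = map sgn xs" "\<forall>d\<in>set (differences ys). 0 < \<rho> * d"
        using increasing_rescaling[OF \<rho>] by blast
      obtain y ys' where y: "ys = y # ys'" "sgn y = sgn x'" using ys xs by (cases ys) auto
      have "0 < \<rho> * y" using \<rho> xs y by (auto simp: zero_less_mult_iff sgn_if split: if_splits)
      with x have "0 < \<rho> * (y - x)" by (simp add: algebra_simps)
      then have d: "\<forall>d\<in>set (differences (x # ys)). 0 < \<rho> * d" "differences (x # ys) \<noteq> []"
        using ys y by auto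
      have r0: "\<rho> \<noteq> 0" using \<rho> xs by auto
      have "Suc (alternations \<sigma> (differences (x # ys))) \<le> alternations (- \<sigma>) (x # xs)"
        if "\<sigma> \<noteq> 0" for \<sigma>
      proof (cases "0 < \<sigma> * \<rho>")
        case True
        then have "- \<sigma> * \<rho> < 0" by simp
        from alternations_one_sign(2)[OF \<rho> this False] True d(1) show ?thesis
          by (simp add: alternations_one_sign(1))
      next
        case False
        then have neg: "\<sigma> * \<rho> < 0" using that r0 by (simp add: not_less order_le_less)
        then have "\<sigma> * x \<ge> 0" using x r0
          by (auto simp: mult_le_0_iff mult_less_0_iff zero_le_mult_iff)
        moreover have "alternations \<sigma> xs = 1"
          using alternations_one_sign(2)[OF \<rho> neg \<open>xs \<noteq> []\<close>] .
        moreover have "alternations \<sigma> (differences (x # ys)) = 1"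
          using alternations_one_sign(2)[OF d(1) neg d(2)] .
        ultimately show ?thesis by simp
      qed
      then show ?thesis using ys(1) by (intro exI[of _ "x # ys"]) auto
    qed
  next
    case False
    then obtain ys where ys: "map sgn ys = map sgn xs"
      "\<And>\<sigma>. \<sigma> \<noteq> 0 \<Longrightarrow> Suc (alternations \<sigma> (differences ys)) \<le> alternations (- \<sigma>) xs"
      using Cons.IH by blast
    from False ys(1) obtain y ys' where y: "ys = y # ys'" by (cases ys) auto
    define z where "z = (if x = 0 then 0 else sgn x * (\<bar>y\<bar> + 1))"
    have z: "sgn z = sgn x" by (auto simp: z_def sgn_mult sgn_if)
    have xd: "x * (y - z) < 0" if "x \<noteq> 0"
      using that by (auto simp: z_def sgn_if mult_less_0_iff)
    have "Suc (alternations \<sigma> (differences (z # ys))) \<le> alternations (- \<sigma>) (x # xs)"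
      if "\<sigma> \<noteq> 0" for \<sigma>
    proof -
      have "Suc (alternations \<sigma> (differences ys)) \<le> alternations (- \<sigma>) xs"
        "Suc (alternations (- \<sigma>) (differences ys)) \<le> alternations \<sigma> xs"
        using ys(2)[of \<sigma>] ys(2)[of "- \<sigma>"] that by auto
      moreover have "\<sigma> * (y - z) < 0 \<longleftrightarrow> 0 < \<sigma> * x" "\<sigma> * (y - z) > 0 \<longleftrightarrow> 0 > \<sigma> * x"
        if "x \<noteq> 0" using xd[OF that] \<open>\<sigma> \<noteq> 0\<close>
        by (auto simp: mult_less_0_iff zero_less_mult_iff)
      ultimately show ?thesis using y alternations_uminus_le[of "- \<sigma>" xs] that
        by (cases "x = 0") (auto simp: not_le not_less order_le_less)
    qed
    then show ?thesis using ys(1) z by (intro exI[of _ "z # ys"]) auto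
  qed
qed auto

lemma sign_changes_Cons2:
  "sign_changes (a # b # s) = (if a \<noteq> b then 1 else 0) + sign_changes (b # s)"
proof -
  have "{i. Suc i < length (a # b # s) \<and> (a # b # s) ! i \<noteq> (a # b # s) ! Suc i}
    = (if a \<noteq> b then {0} else {}) \<union> Suc ` {i. Suc i < length (b # s) \<and> (b # s) ! i \<noteq> (b # s) ! Suc i}"
    (is "?L = ?R")
  proof (rule Set.set_eqI)
    fix i show "i \<in> ?L \<longleftrightarrow> i \<in> ?R" by (cases i) auto
  qed
  then have "sign_changes (a # b # s) = card ((if a \<noteq> b then {0} else {}) \<union> 
    Suc ` {i. Suc i < length (b # s) \<and> (b # s) ! i \<noteq> (b # s) ! Suc i})"
    unfolding sign_changes_def by presburger
  also have "\<dots> = card (if a \<noteq> b then {0::nat} else {}) + card (Suc ` {i. Suc i < length (b # s) \<and> (b # s) ! i \<noteq> (b # s) ! Suc i})"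
    by (rule card_Un_disjoint) auto
  also have "\<dots> = (if a \<noteq> b then 1 else 0) + sign_changes (b # s)"
    unfolding sign_changes_def by (subst card_image) auto
  finally show ?thesis .
qed

lemma sign_changes_short: "sign_changes [] = 0" "sign_changes [a] = 0"
  by (auto simp: sign_changes_def)

definition resolves_sign :: "real \<Rightarrow> real \<Rightarrow> bool" where
  "resolves_sign x a \<longleftrightarrow> (if x = 0 then a \<in> {1, -1} else a = sgn x)"

lemma sign_assignments_list_all2:
  "sign_assignments c = {s. list_all2 resolves_sign (list_of_vec c) s}"
  by (auto simp: sign_assignments_def list_all2_conv_all_nth resolves_sign_def list_of_vec_index)

text \<open>
  The last entries of the maximal blocks of constant sign alternate, starting with the sign
  \<open>a\<close>, and there is one block more than there are sign changes.
\<close>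
lemma sign_changes_le_alternations:
  assumes "list_all2 resolves_sign xs (a # s)"
  shows "Suc (sign_changes (a # s)) \<le> alternations (- a) xs"
  using assms
proof (induction s arbitrary: xs a)
  case Nil
  then obtain x where "xs = [x]" "resolves_sign x a" by (auto simp: list_all2_Cons2)
  then show ?case by (auto simp: resolves_sign_def sgn_if sign_changes_short split: if_splits)
next
  case (Cons b s)
  then obtain x xs' where xs: "xs = x # xs'" "resolves_sign x a"
    and l: "list_all2 resolves_sign xs' (b # s)" by (auto simp: list_all2_Cons2)
  then obtain y where "resolves_sign y b" by (auto simp: list_all2_Cons2)
  with xs have b: "b = a \<or> b = - a" by (auto simp: resolves_sign_def sgn_if split: if_splits)
  have "0 \<le> a * x" using xs by (auto simp: resolves_sign_def sgn_if split: if_splits)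
  then have "alternations (- a) xs = Suc (alternations a xs')" using xs by simp
  with b show ?case
    using Cons.IH[OF l] alternations_uminus_le[of "- a" xs']
    by (auto simp: sign_changes_Cons2)
qed

text \<open>
  Giving a zero the sign that makes the greedy count pick it realizes every alternation as a
  sign change.
\<close>
lemma alternations_attained:
  assumes "\<sigma> = 1 \<or> \<sigma> = - 1"
  shows "\<exists>s. list_all2 resolves_sign xs s \<and> alternations \<sigma> xs \<le> sign_changes (\<sigma> # s)"
  using assms
proof (induction xs arbitrary: \<sigma>)
  case (Cons x xs)
  show ?case
  proof (cases "\<sigma> * x \<le> 0")
    case True
    obtain s where "list_all2 resolves_sign xs s"
      "alternations (- \<sigma>) xs \<le> sign_changes ((- \<sigma>) # s)"
      using Cons.IH[of "- \<sigma>"] Cons.prems by auto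
    moreover have "resolves_sign x (- \<sigma>)" using True Cons.prems
      by (auto simp: resolves_sign_def sgn_if)
    ultimately show ?thesis using True Cons.prems
      by (intro exI[of _ "(- \<sigma>) # s"]) (auto simp: sign_changes_Cons2)
  next
    case False
    obtain s where "list_all2 resolves_sign xs s" "alternations \<sigma> xs \<le> sign_changes (\<sigma> # s)"
      using Cons.IH[of "\<sigma>"] Cons.prems by auto
    moreover have "resolves_sign x \<sigma>" using False Cons.prems
      by (auto simp: resolves_sign_def sgn_if)
    ultimately show ?thesis using False
      by (intro exI[of _ "\<sigma> # s"]) (auto simp: sign_changes_Cons2)
  qed
qed (auto simp: sign_changes_short)

lemma finite_sign_assignments: "finite (sign_assignments c)"
proof (rule finite_subset)
  show "sign_assignments c \<subseteq> {s. set s \<subseteq> {0, 1, -1} \<and> length s = dim_vec c}"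
    by (auto simp: sign_assignments_def in_set_conv_nth sgn_if)
  show "finite {s. set s \<subseteq> {0, 1, -1 :: real} \<and> length s = dim_vec c}"
    by (rule finite_lists_length_eq) simp
qed

lemma Max_sign_changes_le_iff:
  assumes "0 < dim_vec c"
  shows "Max (sign_changes ` sign_assignments c) \<le> m \<longleftrightarrow>
    (\<forall>\<sigma>\<in>{1, -1}. alternations \<sigma> (list_of_vec c) \<le> Suc m)"
proof -
  have ne: "sign_assignments c \<noteq> {}"
    using alternations_attained[of 1 "list_of_vec c"] unfolding sign_assignments_list_all2 by auto
  have l: "list_of_vec c \<noteq> []" using assms by (metis length_list_of_vec length_greater_0_conv)
  have "(\<forall>s\<in>sign_assignments c. sign_changes s \<le> m) \<longleftrightarrow>
    (\<forall>\<sigma>\<in>{1, -1}. alternations \<sigma> (list_of_vec c) \<le> Suc m)" (is "?L \<longleftrightarrow> ?R")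
  proof
    assume L: ?L
    show ?R
    proof
      fix \<sigma> :: real assume "\<sigma> \<in> {1, -1}"
      then obtain s where s: "list_all2 resolves_sign (list_of_vec c) s"
        "alternations \<sigma> (list_of_vec c) \<le> sign_changes (\<sigma> # s)"
        using alternations_attained[of \<sigma> "list_of_vec c"] by auto
      then have "sign_changes s \<le> m" using L unfolding sign_assignments_list_all2 by auto
      moreover obtain b s' where "s = b # s'" using s(1) l by (cases s) auto
      ultimately show "alternations \<sigma> (list_of_vec c) \<le> Suc m"
        using s(2) by (auto simp: sign_changes_Cons2 split: if_splits)
    qed
  next
    assume R: ?R
    show ?L
    proof
      fix s assume "s \<in> sign_assignments c"
      then have s: "list_all2 resolves_sign (list_of_vec c) s"
        unfolding sign_assignments_list_all2 by auto
      then obtain a s' where a: "s = a # s'" using l by (cases s) auto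
      then obtain x where "resolves_sign x a" using s by (auto simp: list_all2_Cons2)
      then have "- a \<in> {1, -1}" by (auto simp: resolves_sign_def sgn_if split: if_splits)
      then show "sign_changes s \<le> m"
        using sign_changes_le_alternations[of "list_of_vec c" a s'] s a R by fastforce
    qed
  qed
  then show ?thesis using ne finite_sign_assignments by auto
qed

section \<open>Positive systems of sequences\<close>

text \<open>
  Here \<open>f j i\<close> is the entry in column \<open>j\<close> and row \<open>i\<close>. The minor uses the first \<open>m\<close> columns
  and the \<open>m\<close> consecutive rows from \<open>a\<close> on; it is the discrete counterpart of the Wronskian of
  \<open>m\<close> functions at the point \<open>a\<close>.
\<close>
definition initial_minor :: "(nat \<Rightarrow> nat \<Rightarrow> real) \<Rightarrow> nat \<Rightarrow> nat \<Rightarrow> real" where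
  "initial_minor f a m = det (mat m m (\<lambda>(r, c). f c (a + r)))"

text \<open>
  The discrete counterpart of a system of \<open>k\<close> functions with positive Wronskians, on the \<open>n\<close>
  points \<open>0, \<dots>, n - 1\<close>.
\<close>
definition positive_system :: "nat \<Rightarrow> nat \<Rightarrow> (nat \<Rightarrow> nat \<Rightarrow> real) \<Rightarrow> bool" where
  "positive_system k n f \<longleftrightarrow> (\<forall>a m. m \<le> k \<and> a + m \<le> n \<longrightarrow> 0 < initial_minor f a m)"

text \<open>
  Dividing by the first column kills it under differencing; the other columns form the reduced
  system.
\<close>
definition reduced_system :: "(nat \<Rightarrow> nat \<Rightarrow> real) \<Rightarrow> nat \<Rightarrow> nat \<Rightarrow> real" where
  "reduced_system f j i = f (Suc j) (Suc i) / f 0 (Suc i) - f (Suc j) i / f 0 i"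

lemma initial_minor_0 [simp]: "initial_minor f a 0 = 1"
  by (simp add: initial_minor_def)

lemma initial_minor_Suc_0 [simp]: "initial_minor f a (Suc 0) = f 0 a"
  unfolding initial_minor_def by (subst det_single) auto

text \<open>
  Polya's factorization of the Wronskian, in discrete form: after division of each row by its
  first entry, subtracting from each row the previous one leaves the first unit vector in the
  first column.
\<close>
lemma initial_minor_Suc:
  assumes nz: "\<And>i. i \<le> m \<Longrightarrow> f 0 (a + i) \<noteq> 0"
  shows "initial_minor f a (Suc m) = (\<Prod>i\<le>m. f 0 (a + i)) * initial_minor (reduced_system f) a m"
proof -
  let ?h = "\<lambda>c r. f c (a + r) / f 0 (a + r)"
  define M where "M = mat (Suc m) (Suc m) (\<lambda>(r, c). f c (a + r))"
  define L where "L = mat (Suc m) (Suc m) (\<lambda>(r, s). if s \<le> r then f 0 (a + r) else 0)"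
  define R where "R = mat m m (\<lambda>(r, c). reduced_system f c (a + r))"
  define N where "N = four_block_mat (mat 1 1 (\<lambda>_. 1 :: real)) (mat 1 m (\<lambda>(r, c). ?h (Suc c) 0)) (0\<^sub>m m 1) R"
  have N: "N \<in> carrier_mat (Suc m) (Suc m)" unfolding N_def R_def by auto
  have L: "L \<in> carrier_mat (Suc m) (Suc m)" unfolding L_def by auto
  \<comment> \<open>\<open>L\<close> undoes the operations: row \<open>r\<close> of \<open>M\<close> is \<open>f 0 (a + r)\<close> times the sum of rows \<open>0, \<dots>, r\<close> of \<open>N\<close>.\<close>
  have N_index: "N $$ (s, c) = (if s = 0 then ?h c 0 else ?h c s - ?h c (s - 1))"
    if "s \<le> m" "c \<le> m" for s c
  proof -
    have s0: "s = 0 \<or> s = Suc (s - 1)" and c0: "c = 0 \<or> c = Suc (c - 1)" by auto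
    have *: "N $$ (s, c) = (if s < 1 then if c < 1 then 1 else ?h (Suc (c - 1)) 0
        else if c < 1 then 0 else reduced_system f (c - 1) (a + (s - 1)))"
      using that unfolding N_def R_def by (subst index_mat_four_block) auto
    show ?thesis
      unfolding * using nz[of s] nz[of "s - 1"] that s0 c0 by (cases s; cases c) (auto simp: reduced_system_def)
  qed
  have "M = L * N"
  proof (rule eq_matI)
    fix r c assume rc: "r < dim_row (L * N)" "c < dim_col (L * N)"
    then have r: "r \<le> m" and c: "c \<le> m" using L N by auto
    have "(L * N) $$ (r, c) = (\<Sum>s\<in>{0..<Suc m}. L $$ (r, s) * N $$ (s, c))"
      using rc L N by (auto simp: scalar_prod_def)
    also have "\<dots> = (\<Sum>s\<in>{0..r}. f 0 (a + r) * N $$ (s, c))"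
      using r by (intro sum.mono_neutral_cong_right) (auto simp: L_def)
    also have "\<dots> = f 0 (a + r) * (\<Sum>s\<le>r. N $$ (s, c))"
      by (simp add: sum_distrib_left atLeast0AtMost)
    also have "(\<Sum>s\<le>r. N $$ (s, c)) = ?h c r"
      using r
    proof (induction r)
      case (Suc r)
      then show ?case using c N_index[of "Suc r" c] by simp
    qed (use c N_index[of 0 c] in simp)
    finally show "M $$ (r, c) = (L * N) $$ (r, c)"
      using nz[of r] r c by (simp add: M_def)
  qed (use L N in \<open>auto simp: M_def\<close>)
  then have "det M = det L * det N" using det_mult[OF L N] by simp
  also have "det L = (\<Prod>i\<le>m. f 0 (a + i))"
    by (subst det_lower_triangular[OF _ L])
      (auto simp: L_def diag_mat_def atLeast0LessThan lessThan_Suc_atMost[symmetric]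
        simp flip: prod.distinct_set_conv_list)
  also have "det N = det R" unfolding N_def
    by (subst det_four_block_mat_lower_left_zero_col[of _ _ m]) (auto simp: R_def det_single[of "mat (Suc 0) (Suc 0) _"])
  finally show ?thesis by (simp add: M_def R_def initial_minor_def)
qed

lemma positive_system_first_pos:
  assumes "positive_system (Suc k) n f" "i < n"
  shows "0 < f 0 i"
proof -
  have "0 < initial_minor f i (Suc 0)"
    using assms unfolding positive_system_def by (metis Suc_leI Suc_le_mono add_Suc_right le0 add_0_right)
  then show ?thesis by simp
qed

lemma positive_system_reduced_iff:
  assumes "\<And>i. i < n \<Longrightarrow> 0 < f 0 i"
  shows "positive_system (Suc k) n f \<longleftrightarrow> positive_system k (n - 1) (reduced_system f)"
proof -
  have *: "0 < initial_minor f a (Suc m) \<longleftrightarrow> 0 < initial_minor (reduced_system f) a m"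
    if "a + Suc m \<le> n" for a m
  proof -
    have pos: "0 < f 0 (a + i)" if "i \<le> m" for i
      using that \<open>a + Suc m \<le> n\<close> by (intro assms) simp
    then have "0 < (\<Prod>i\<le>m. f 0 (a + i))" by (intro prod_pos) simp
    moreover have "initial_minor f a (Suc m) = (\<Prod>i\<le>m. f 0 (a + i)) * initial_minor (reduced_system f) a m"
      using pos by (intro initial_minor_Suc) force
    ultimately show ?thesis by (simp add: zero_less_mult_iff)
  qed
  show ?thesis
  proof
    assume L: "positive_system (Suc k) n f"
    show "positive_system k (n - 1) (reduced_system f)"
      unfolding positive_system_def
    proof (intro allI impI, elim conjE)
      fix a m assume m: "m \<le> k" "a + m \<le> n - 1"
      show "0 < initial_minor (reduced_system f) a m"
      proof (cases "m = 0")
        case False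
        then have "a + Suc m \<le> n" using m by simp
        then show ?thesis using L m(1) *[of a m] unfolding positive_system_def by simp
      qed simp
    qed
  next
    assume R: "positive_system k (n - 1) (reduced_system f)"
    show "positive_system (Suc k) n f"
      unfolding positive_system_def
    proof (intro allI impI, elim conjE)
      fix a m assume m: "m \<le> Suc k" "a + m \<le> n"
      show "0 < initial_minor f a m"
      proof (cases m)
        case (Suc m')
        then have "0 < initial_minor (reduced_system f) a m'"
          using R m unfolding positive_system_def by simp
        then show ?thesis using Suc m *[of a m'] by simp
      qed simp
    qed
  qed
qed

lemma length_differences: "length (differences xs) = length xs - 1"
  by (induction xs rule: differences.induct) auto

lemma nth_differences:
  "Suc i < length xs \<Longrightarrow> differences xs ! i = xs ! Suc i - xs ! i"
proof (induction xs arbitrary: i rule: differences.induct)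
  case (1 x y xs)
  then show ?case by (cases i) auto
qed auto

lemma differences_map_upt:
  "differences (map u [0..<n]) = map (\<lambda>i. u (Suc i) - u i) [0..<n - 1]"
proof (rule nth_equalityI)
  fix i assume "i < length (differences (map u [0..<n]))"
  then have "Suc i < n" by (simp add: length_differences)
  then show "differences (map u [0..<n]) ! i = map (\<lambda>i. u (Suc i) - u i) [0..<n - 1] ! i"
    by (subst nth_differences) auto
qed (simp add: length_differences)

lemma reduced_combination:
  assumes "\<And>i. i < n \<Longrightarrow> f 0 i \<noteq> 0" "Suc i < n"
  shows "(\<Sum>j<Suc k. c j * f j (Suc i)) / f 0 (Suc i) - (\<Sum>j<Suc k. c j * f j i) / f 0 i
    = (\<Sum>j<k. c (Suc j) * reduced_system f j i)"
  using assms by (simp add: sum.lessThan_Suc_shift add_divide_distrib sum_divide_distrib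
      sum_subtractf[symmetric] reduced_system_def right_diff_distrib del: sum.lessThan_Suc)

text \<open>
  By induction on the number of columns: division by the positive first column does not change
  signs, and differencing loses at most one alternation while it leads to a combination of one
  column fewer.
\<close>
lemma alternations_combination_le:
  assumes "positive_system k n f" "\<exists>j<k. c j \<noteq> 0" "\<sigma> \<noteq> 0"
  shows "alternations \<sigma> (map (\<lambda>i. \<Sum>j<k. c j * f j i) [0..<n]) \<le> k"
  using assms
proof (induction k arbitrary: n f c \<sigma>)
  case (Suc k)
  have pos: "0 < f 0 i" if "i < n" for i
    using positive_system_first_pos[OF Suc.prems(1) that] .
  let ?u = "\<lambda>i. \<Sum>j<Suc k. c j * f j i"
  show ?case
  proof (cases "\<exists>j<k. c (Suc j) \<noteq> 0")
    case True
    let ?w = "map (\<lambda>i. ?u i / f 0 i) [0..<n]"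
    have "alternations \<sigma> (map ?u [0..<n]) = alternations \<sigma> ?w"
      using pos by (intro alternations_cong_sgn) (auto simp: sgn_divide simp del: sum.lessThan_Suc)
    also have "\<dots> \<le> Suc (alternations (- \<sigma>) (differences ?w))"
      using alternations_le_differences[of "- \<sigma>" ?w] by simp
    also have "differences ?w = map (\<lambda>i. \<Sum>j<k. c (Suc j) * reduced_system f j i) [0..<n - 1]"
      unfolding differences_map_upt
      by (rule map_cong, simp, rule reduced_combination[where n = n]) (use pos in force)+
    also have "alternations (- \<sigma>) \<dots> \<le> k"
      using Suc.prems pos True by (intro Suc.IH) (simp_all add: positive_system_reduced_iff)
    finally show ?thesis by simp
  next
    case False
    with Suc.prems(2) have c: "c 0 \<noteq> 0" using less_Suc_eq_0_disj by force
    have u: "?u i = c 0 * f 0 i" for i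
      using False by (simp add: sum.lessThan_Suc_shift del: sum.lessThan_Suc)
    have s: "\<forall>x\<in>set (map ?u [0..<n]). 0 < c 0 * x"
    proof
      fix x assume "x \<in> set (map ?u [0..<n])"
      then obtain i where "i < n" "x = c 0 * f 0 i" using u by auto
      then show "0 < c 0 * x" using c pos[of i] by (auto simp: zero_less_mult_iff mult_less_0_iff neq_iff)
    qed
    consider "0 < \<sigma> * c 0" | "\<sigma> * c 0 < 0"
      using c Suc.prems(3) by (metis linorder_neqE_linordered_idom mult_eq_0_iff)
    then show ?thesis
    proof cases
      case 1
      from alternations_one_sign(1)[OF s this] show ?thesis by simp
    next
      case 2
      from alternations_one_sign(2)[OF s this] show ?thesis
        by (cases "map ?u [0..<n] = []") (auto simp del: sum.lessThan_Suc)
    qed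
  qed
qed simp

text \<open>
  The reduction to fewer columns, run backwards. Weights \<open>1 / p\<close> are chosen such that the
  differences of \<open>u / p\<close> have at least one alternation fewer, or vanish. A system for these
  differences exists by induction, and partial summation followed by multiplication with \<open>p\<close>
  turns it into a system for \<open>u\<close> whose first column is \<open>p\<close>.
\<close>
lemma positive_system_through_vector:
  assumes "\<forall>\<sigma>\<in>{1, -1}. alternations \<sigma> (map u [0..<n]) \<le> k"
  shows "\<exists>f c. positive_system n n f \<and> (\<forall>i<n. u i = (\<Sum>j<k. c j * f j i))"
  using assms
proof (induction n arbitrary: u k)
  case 0
  then show ?case by (auto simp: positive_system_def)
next
  case (Suc n)
  from Suc.prems alternations_pos[of "map u [0..<Suc n]" 1] obtain k' where k: "k = Suc k'"
    by (cases k) auto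
  \<comment> \<open>The constant of summation \<open>u 0 / p 0\<close> is the coefficient of the first column.\<close>
  have step: ?case
    if p: "\<And>i. i \<le> n \<Longrightarrow> 0 < p i"
      and f: "positive_system n n f"
      and w: "\<And>i. i < n \<Longrightarrow> u (Suc i) / p (Suc i) - u i / p i = (\<Sum>j<k'. c j * f j i)"
    for p f c
  proof -
    define F where "F = (\<lambda>j i. p i * (case j of 0 \<Rightarrow> 1 | Suc j' \<Rightarrow> \<Sum>l<i. f j' l))"
    define C where "C = (\<lambda>j. case j of 0 \<Rightarrow> u 0 / p 0 | Suc j' \<Rightarrow> c j')"
    have "initial_minor (reduced_system F) a m = initial_minor f a m" if "a + m \<le> n" for a m
      unfolding initial_minor_def
    proof (rule arg_cong[where f = det], rule eq_matI)
      fix r s assume "r < dim_row (mat m m (\<lambda>(r, c). f c (a + r)))"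
        "s < dim_col (mat m m (\<lambda>(r, c). f c (a + r)))"
      moreover from this have "p (a + r) \<noteq> 0" "p (Suc (a + r)) \<noteq> 0"
        using p[of "a + r"] p[of "Suc (a + r)"] that by auto
      ultimately show "mat m m (\<lambda>(r, c). reduced_system F c (a + r)) $$ (r, s) =
          mat m m (\<lambda>(r, c). f c (a + r)) $$ (r, s)"
        by (simp add: reduced_system_def F_def)
    qed auto
    then have "positive_system n n (reduced_system F)" using f by (simp add: positive_system_def)
    then have "positive_system (Suc n) (Suc n) F"
      using p by (subst positive_system_reduced_iff) (auto simp: F_def)
    moreover have "u i = (\<Sum>j<k. C j * F j i)" if "i < Suc n" for i
    proof -
      have "u i / p i = u 0 / p 0 + (\<Sum>j<k'. c j * (\<Sum>l<i. f j l))"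
        using that
      proof (induction i)
        case (Suc i)
        then show ?case using w[of i]
          by (simp add: sum.distrib distrib_left)
      qed simp
      then have "u i = p i * (u 0 / p 0 + (\<Sum>j<k'. c j * (\<Sum>l<i. f j l)))"
        using p[of i] that by (simp add: field_simps)
      then show ?thesis
        by (simp add: k sum.lessThan_Suc_shift C_def F_def sum_distrib_left algebra_simps del: sum.lessThan_Suc)
    qed
    ultimately show ?thesis by blast
  qed
  show ?case
  proof (cases "\<exists>\<rho>. \<forall>x\<in>set (map u [0..<Suc n]). 0 < \<rho> * x")
    case True
    then obtain \<rho> where \<rho>: "0 < \<rho> * u i" if "i \<le> n" for i by (force simp: less_Suc_eq_le)
    \<comment> \<open>The vector \<open>u\<close> is a multiple of the first column, so any positive system may follow.\<close>
    obtain f where f: "positive_system n n f"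
      using Suc.IH[of "\<lambda>_. 1" n] alternations_le_length[of _ "map (\<lambda>_. 1) [0..<n]"] by fastforce
    have "u i / (\<rho> * u i) = 1 / \<rho>" if "i \<le> n" for i using \<rho>[OF that] by (auto simp: field_simps)
    then show ?thesis
      by (intro step[of "\<lambda>i. \<rho> * u i" f "\<lambda>_. 0"]) (use \<rho> f in auto)
  next
    case False
    from rescaling_decreases_alternations[OF this] obtain ys
      where ys: "map sgn ys = map sgn (map u [0..<Suc n])" and
        le: "\<And>\<sigma>. \<sigma> \<noteq> 0 \<Longrightarrow> Suc (alternations \<sigma> (differences ys)) \<le> alternations (- \<sigma>) (map u [0..<Suc n])"
      by blast
    define y where "y = (!) ys"
    have len: "length ys = Suc n" using ys map_eq_imp_length_eq by fastforce
    then have ysy: "ys = map y [0..<Suc n]" by (metis map_nth y_def)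
    have sgn: "sgn (y i) = sgn (u i)" if "i \<le> n" for i
      using ys that unfolding ysy by (auto simp: less_Suc_eq_le dest: le_neq_implies_less)
    define p where "p = (\<lambda>i. if u i = 0 then 1 else u i / y i)"
    have p: "0 < p i" "u i / p i = y i" if "i \<le> n" for i
      using sgn[OF that] by (auto simp: p_def sgn_if zero_less_divide_iff split: if_splits)
    have "\<forall>\<sigma>\<in>{1, -1}. alternations \<sigma> (map (\<lambda>i. y (Suc i) - y i) [0..<n]) \<le> k'"
      using le[of 1] le[of "- 1"] Suc.prems unfolding ysy differences_map_upt k by auto
    from Suc.IH[OF this] obtain f c where "positive_system n n f"
      "\<forall>i<n. y (Suc i) - y i = (\<Sum>j<k'. c j * f j i)" by blast
    then show ?thesis by (intro step[of p f c]) (use p in auto)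
  qed
qed

section \<open>Orientation classes and determinants\<close>

lemma base_change_refl: "set bs \<subseteq> carrier_vec n \<Longrightarrow> base_change n (1\<^sub>m (length bs)) bs bs"
  unfolding base_change_def by (auto intro!: right_mult_one_mat[symmetric])

lemma base_change_trans:
  assumes "base_change n A bs cs" "base_change n B cs ds"
  shows "base_change n (A * B) bs ds"
  using assms unfolding base_change_def
  by (auto intro!: assoc_mult_mat simp: mult_carrier_mat[of A "length bs" "length bs" B "length bs"])

lemma base_change_inverse:
  assumes "base_change n A bs cs" "det A \<noteq> 0" "set bs \<subseteq> carrier_vec n"
  obtains B where "base_change n B cs bs" "det A * det B = 1"
proof -
  let ?d = "length bs"
  have A: "A \<in> carrier_mat ?d ?d" using assms(1) by (simp add: base_change_def)
  from det_non_zero_imp_unit[OF A assms(2), of class_ring]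
  obtain B where B: "B \<in> carrier_mat ?d ?d" "A * B = 1\<^sub>m ?d"
    unfolding Units_def ring_mat_def by auto
  have "mat_of_cols n cs * B = mat_of_cols n bs * (A * B)"
    using assms(1) A B unfolding base_change_def by (simp add: assoc_mult_mat[of _ n ?d _ ?d _ ?d])
  then have "mat_of_cols n bs = mat_of_cols n cs * B" using B(2) by simp
  then have "base_change n B cs bs" using B assms(1,3) unfolding base_change_def by simp
  moreover have "det A * det B = 1" using det_mult[OF A B(1)] B(2) by simp
  ultimately show ?thesis using that by blast
qed

lemma orientation_class_self: "set bs \<subseteq> carrier_vec n \<Longrightarrow> bs \<in> orientation_class n bs"
  unfolding orientation_class_def using base_change_refl[of bs n] by (auto intro!: exI[of _ "1\<^sub>m (length bs)"])

lemma orientation_class_carrier: "cs \<in> orientation_class n bs \<Longrightarrow> set cs \<subseteq> carrier_vec n"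
  unfolding orientation_class_def base_change_def by auto

lemma orientation_class_length: "cs \<in> orientation_class n bs \<Longrightarrow> length cs = length bs"
  unfolding orientation_class_def base_change_def by auto

lemma orientation_class_base_change_subset:
  assumes "base_change n A bs cs" "0 < det A"
  shows "orientation_class n cs \<subseteq> orientation_class n bs"
proof
  fix ds assume "ds \<in> orientation_class n cs"
  then obtain B where B: "base_change n B cs ds" "0 < det B" by (auto simp: orientation_class_def)
  have "det (A * B) = det A * det B"
    using assms B by (intro det_mult[of _ "length bs"]) (auto simp: base_change_def)
  then show "ds \<in> orientation_class n bs"
    using base_change_trans[OF assms(1) B(1)] assms(2) B(2) unfolding orientation_class_def by fastforce
qed

lemma orientation_class_base_change:
  assumes "base_change n A bs cs" "0 < det A" "set bs \<subseteq> carrier_vec n"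
  shows "orientation_class n cs = orientation_class n bs"
proof (rule subset_antisym)
  obtain B where B: "base_change n B cs bs" "det A * det B = 1"
    using base_change_inverse[OF assms(1) _ assms(3)] assms(2) by auto
  then have "0 < det B" using assms(2) zero_less_mult_pos[of "det A" "det B"] by simp
  then show "orientation_class n bs \<subseteq> orientation_class n cs"
    using orientation_class_base_change_subset[OF B(1)] by blast
qed (rule orientation_class_base_change_subset[OF assms(1,2)])

lemma orientation_class_eq:
  "cs \<in> orientation_class n bs \<Longrightarrow> set bs \<subseteq> carrier_vec n \<Longrightarrow>
    orientation_class n cs = orientation_class n bs"
  using orientation_class_base_change by (fastforce simp: orientation_class_def[of n bs])

lemma orientation_class_Nil [simp]: "orientation_class n [] = {[]}"
proof -
  have "orientation_class n [] \<subseteq> {[]}" using orientation_class_length[of _ n "[]"] by auto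
  moreover have "[] \<in> orientation_class n []" by (rule orientation_class_self) simp
  ultimately show ?thesis by auto
qed

lemma base_changeI:
  assumes "A \<in> carrier_mat (length bs) (length bs)" "length cs = length bs" "set cs \<subseteq> carrier_vec n"
    and "\<And>j r. j < length bs \<Longrightarrow> r < n \<Longrightarrow>
      cs ! j $ r = (\<Sum>l<length bs. bs ! l $ r * A $$ (l, j))"
  shows "base_change n A bs cs"
  unfolding base_change_def
proof (intro conjI assms eq_matI)
  fix r j assume "r < dim_row (mat_of_cols n bs * A)" "j < dim_col (mat_of_cols n bs * A)"
  then have "r < n" "j < length bs" using assms(1) by auto
  then show "mat_of_cols n cs $$ (r, j) = (mat_of_cols n bs * A) $$ (r, j)"
    using assms by (auto simp: scalar_prod_def mat_of_cols_index atLeast0LessThan)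
qed (use assms in auto)

lemma base_changeD:
  assumes "base_change n A bs cs" "j < length bs" "r < n"
  shows "cs ! j $ r = (\<Sum>l<length bs. bs ! l $ r * A $$ (l, j))"
proof -
  have "length cs = length bs" using assms(1) by (simp add: base_change_def)
  then have "cs ! j $ r = mat_of_cols n cs $$ (r, j)"
    using assms(2,3) by (simp add: mat_of_cols_index)
  also have "\<dots> = (mat_of_cols n bs * A) $$ (r, j)" using assms by (simp add: base_change_def)
  also have "\<dots> = (\<Sum>l<length bs. bs ! l $ r * A $$ (l, j))"
    using assms(2,3) carrier_matD[of A "length bs" "length bs"] assms(1)[unfolded base_change_def]
    by (subst index_mult_mat(1)) (auto simp: scalar_prod_def mat_of_cols_index atLeast0LessThan)
  finally show ?thesis .
qed

lemma sum_lessThan_add: "(\<Sum>l<p + q. f l) = (\<Sum>l<p. f l) + (\<Sum>l<q. f (p + l :: nat) :: real)"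
  by (induction q) (auto simp: add.assoc)

lemma base_change_append:
  assumes bs: "base_change n A bs bs'" and cs: "base_change n B cs cs'"
  shows "base_change n (four_block_mat A (0\<^sub>m (length bs) (length cs)) (0\<^sub>m (length cs) (length bs)) B)
    (bs @ cs) (bs' @ cs')"
proof (rule base_changeI)
  have A: "A \<in> carrier_mat (length bs) (length bs)" and B: "B \<in> carrier_mat (length cs) (length cs)"
    and l: "length bs' = length bs" "length cs' = length cs"
    using assms by (auto simp: base_change_def)
  then show "four_block_mat A (0\<^sub>m (length bs) (length cs)) (0\<^sub>m (length cs) (length bs)) B
    \<in> carrier_mat (length (bs @ cs)) (length (bs @ cs))"
    and "length (bs' @ cs') = length (bs @ cs)" by auto
  show "set (bs' @ cs') \<subseteq> carrier_vec n" using assms by (auto simp: base_change_def)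
  fix j r assume jr: "j < length (bs @ cs)" "r < n"
  show "(bs' @ cs') ! j $ r = (\<Sum>l<length (bs @ cs). (bs @ cs) ! l $ r *
      four_block_mat A (0\<^sub>m (length bs) (length cs)) (0\<^sub>m (length cs) (length bs)) B $$ (l, j))"
    using jr A B l base_changeD[OF bs, of j r] base_changeD[OF cs, of "j - length bs" r]
    by (auto simp: sum_lessThan_add nth_append)
qed

lemma oriented_sum_orientation_class:
  assumes "set bs \<subseteq> carrier_vec n" "set cs \<subseteq> carrier_vec n"
  shows "oriented_sum n (orientation_class n bs) (orientation_class n cs) = orientation_class n (bs @ cs)"
proof
  show "oriented_sum n (orientation_class n bs) (orientation_class n cs) \<subseteq> orientation_class n (bs @ cs)"
  proof
    fix ds assume "ds \<in> oriented_sum n (orientation_class n bs) (orientation_class n cs)"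
    then obtain bs' cs' A B where A: "base_change n A bs bs'" "0 < det A"
      and B: "base_change n B cs cs'" "0 < det B" and ds: "ds \<in> orientation_class n (bs' @ cs')"
      unfolding oriented_sum_def orientation_class_def[of n bs] orientation_class_def[of n cs] by blast
    let ?D = "four_block_mat A (0\<^sub>m (length bs) (length cs)) (0\<^sub>m (length cs) (length bs)) B"
    have "det ?D = det A * det B"
      using A B by (intro det_four_block_mat_lower_left_zero) (auto simp: base_change_def)
    then show "ds \<in> orientation_class n (bs @ cs)"
      using orientation_class_base_change_subset[OF base_change_append[OF A(1) B(1)]] A B ds by auto
  qed
  show "orientation_class n (bs @ cs) \<subseteq> oriented_sum n (orientation_class n bs) (orientation_class n cs)"
    unfolding oriented_sum_def using orientation_class_self assms by blast
qed

lemma mat_of_cols_unit_vecs: "mat_of_cols n (unit_vecs n) = 1\<^sub>m n"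
  by (intro eq_matI) (auto simp: mat_of_cols_index unit_vecs_def)

lemma mem_standard_orientation_iff:
  "bs \<in> standard_orientation n \<longleftrightarrow>
    length bs = n \<and> set bs \<subseteq> carrier_vec n \<and> 0 < det (mat_of_cols n bs)"
proof -
  have "base_change n A (unit_vecs n) bs \<longleftrightarrow>
      length bs = n \<and> set bs \<subseteq> carrier_vec n \<and> A = mat_of_cols n bs" for A
    unfolding base_change_def mat_of_cols_unit_vecs vec_space.unit_vecs_length by auto
  then show ?thesis by (auto simp: standard_orientation_def orientation_class_def)
qed

lemma unit_vecs_carrier: "set (unit_vecs n) \<subseteq> carrier_vec n"
  by (auto simp: unit_vecs_def)

text \<open>
  This turns equations between oriented sums into positivity of determinants, by way of
  \<open>mem_standard_orientation_iff\<close>.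
\<close>
lemma orientation_class_eq_standard_iff:
  assumes "set bs \<subseteq> carrier_vec n"
  shows "orientation_class n bs = standard_orientation n \<longleftrightarrow> bs \<in> standard_orientation n"
  using orientation_class_self[OF assms] orientation_class_eq[OF _ unit_vecs_carrier]
  unfolding standard_orientation_def by metis

lemma rspan_eq:
  assumes "set bs \<subseteq> carrier_vec n"
  shows "rspan n (set bs) = {mat_of_cols n bs *\<^sub>v c | c. c \<in> carrier_vec (length bs)}"
proof -
  interpret vec_space "TYPE(real)" n .
  have "span (set (cols (mat_of_cols n bs))) = {y \<in> carrier_vec n. \<exists>x\<in>carrier_vec (length bs). mat_of_cols n bs *\<^sub>v x = y}"
    using col_space_eq[of "mat_of_cols n bs" "length bs"] unfolding col_space_def by simp
  then show ?thesis using cols_mat_of_cols[OF assms]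
    by (auto intro: mult_mat_vec_carrier[of _ n "length bs"])
qed

lemma mat_mult_unit_vec:
  assumes "A \<in> carrier_mat n m" "l < m"
  shows "A *\<^sub>v unit_vec m l = (col A l :: 'a :: semiring_1 vec)"
proof (rule eq_vecI)
  fix i assume "i < dim_vec (col A l)"
  then show "(A *\<^sub>v unit_vec m l) $ i = col A l $ i"
    using assms scalar_prod_right_unit[of l m "row A i"] by auto
qed (use assms in auto)

text \<open>
  A list with a repetition has a kernel vector, so injectivity of the matrix covers
  distinctness as well.
\<close>
lemma lin_indpt_list_iff:
  "lin_indpt_list n bs \<longleftrightarrow> set bs \<subseteq> carrier_vec n \<and>
    (\<forall>c\<in>carrier_vec (length bs). mat_of_cols n bs *\<^sub>v c = 0\<^sub>v n \<longrightarrow> c = 0\<^sub>v (length bs))"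
proof (cases "set bs \<subseteq> carrier_vec n")
  case True
  interpret vec_space "TYPE(real)" n .
  let ?B = "mat_of_cols n bs"
  have B: "?B \<in> carrier_mat n (length bs)" by simp
  have cols: "cols ?B = bs" using True by simp
  show ?thesis
  proof (cases "distinct bs")
    case d: True
    show ?thesis
      using True d lin_depI[OF B] lin_depE[OF B] unfolding lin_indpt_list_def cols by metis
  next
    case False
    then obtain i j where ij: "i < length bs" "j < length bs" "i \<noteq> j" "bs ! i = bs ! j"
      by (auto simp: distinct_conv_nth)
    define c :: "real vec" where "c = unit_vec (length bs) i - unit_vec (length bs) j"
    have "?B *\<^sub>v c = ?B *\<^sub>v unit_vec (length bs) i - ?B *\<^sub>v unit_vec (length bs) j"
      unfolding c_def by (rule mult_minus_distrib_mat_vec) auto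
    also have "\<dots> = 0\<^sub>v n"
    proof -
      have "?B *\<^sub>v unit_vec (length bs) l = bs ! l" if "l < length bs" for l
        using that True mat_mult_unit_vec[OF B that] by (simp add: subset_iff)
      then show ?thesis using ij True by (auto simp: subset_iff intro: minus_cancel_vec)
    qed
    finally have "?B *\<^sub>v c = 0\<^sub>v n" .
    moreover have "c \<in> carrier_vec (length bs)" by (simp add: c_def)
    moreover have "c $ i \<noteq> 0" using ij by (simp add: c_def)
    then have "c \<noteq> 0\<^sub>v (length bs)" using ij by auto
    ultimately show ?thesis using False unfolding lin_indpt_list_def by blast
  qed
qed (simp add: lin_indpt_list_def)

lemma lin_indpt_list_carrier: "lin_indpt_list n bs \<Longrightarrow> set bs \<subseteq> carrier_vec n"
  by (simp add: lin_indpt_list_def)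

lemma lin_indpt_list_mset:
  "mset bs = mset cs \<Longrightarrow> lin_indpt_list n bs \<longleftrightarrow> lin_indpt_list n cs"
  unfolding lin_indpt_list_def by (metis mset_eq_imp_distinct_iff mset_eq_setD)

lemma lin_indpt_list_sublist:
  assumes "lin_indpt_list n bs" "set cs \<subseteq> set bs" "distinct cs"
  shows "lin_indpt_list n cs"
proof -
  interpret vec_space "TYPE(real)" n .
  show ?thesis using assms subset_li_is_li unfolding lin_indpt_list_def by blast
qed

lemma lin_indpt_list_square_iff:
  assumes "length bs = n"
  shows "lin_indpt_list n bs \<longleftrightarrow> set bs \<subseteq> carrier_vec n \<and> det (mat_of_cols n bs) \<noteq> 0"
  using det_0_iff_vec_prod_zero_field[of "mat_of_cols n bs" n] mat_of_cols_carrier(1)[of n bs] assms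
  unfolding lin_indpt_list_iff by auto

lemma lin_indpt_list_base_change:
  assumes "lin_indpt_list n bs" "base_change n A bs cs" "det A \<noteq> 0"
  shows "lin_indpt_list n cs"
  unfolding lin_indpt_list_iff
proof (intro conjI ballI impI)
  let ?d = "length bs"
  have A: "A \<in> carrier_mat ?d ?d" and l: "length cs = ?d"
    and cs: "mat_of_cols n cs = mat_of_cols n bs * A" "set cs \<subseteq> carrier_vec n"
    using assms(2) by (auto simp: base_change_def)
  show "set cs \<subseteq> carrier_vec n" by fact
  fix c assume c: "c \<in> carrier_vec (length cs)" "mat_of_cols n cs *\<^sub>v c = 0\<^sub>v n"
  then have "mat_of_cols n bs *\<^sub>v (A *\<^sub>v c) = 0\<^sub>v n"
    using A l cs by (simp add: assoc_mult_mat_vec[of _ n ?d])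
  then have "A *\<^sub>v c = 0\<^sub>v ?d"
    using assms(1) A c l unfolding lin_indpt_list_iff by (metis mult_mat_vec_carrier)
  then show "c = 0\<^sub>v (length cs)"
    using det_0_iff_vec_prod_zero_field[OF A] assms(3) c l by auto
qed

lemma lin_indpt_list_orientation_class:
  "lin_indpt_list n bs \<Longrightarrow> cs \<in> orientation_class n bs \<Longrightarrow> lin_indpt_list n cs"
  using lin_indpt_list_base_change by (fastforce simp: orientation_class_def)

lemma lin_indpt_list_extend:
  assumes "lin_indpt_list n bs" "length bs < n"
  shows "\<exists>x. lin_indpt_list n (bs @ [x])"
proof -
  interpret vec_space "TYPE(real)" n .
  have bs: "set bs \<subseteq> carrier_vec n" "distinct bs" "lin_indpt (set bs)"
    using assms(1) by (auto simp: lin_indpt_list_def)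
  have "span (set bs) \<noteq> carrier_vec n"
  proof
    assume "span (set bs) = carrier_vec n"
    then have "dim \<le> card (set bs)" using bs by (intro gen_ge_dim) auto
    then show False using assms(2) dim_is_n card_length[of bs] by simp
  qed
  then obtain x where x: "x \<in> carrier_vec n" "x \<notin> span (set bs)"
    using span_is_subset2[of "set bs"] bs(1) by auto
  then have "x \<notin> set bs" using in_own_span[of "set bs"] bs by auto
  with lin_dep_iff_in_span[of "set bs" x] x bs have "lin_indpt (set (bs @ [x]))" by auto
  then show ?thesis using x \<open>x \<notin> set bs\<close> bs by (auto simp: lin_indpt_list_def)
qed

lemma base_change_in_span:
  assumes "base_change n A bs cs" "set bs \<subseteq> carrier_vec n"
  shows "set cs \<subseteq> rspan n (set bs)"
proof
  fix v assume "v \<in> set cs"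
  have c: "set cs \<subseteq> carrier_vec n" using assms(1) by (simp add: base_change_def)
  obtain j where j: "j < length cs" "v = cs ! j" using \<open>v \<in> set cs\<close> by (auto simp: in_set_conv_nth)
  have "v = col (mat_of_cols n cs) j" using j c by (simp add: subset_iff)
  also have "\<dots> = mat_of_cols n bs *\<^sub>v col A j"
    using assms(1) j by (auto simp: base_change_def intro!: col_mult2[of _ n "length bs" _ "length bs"])
  finally show "v \<in> rspan n (set bs)" using assms(1) j unfolding rspan_eq[OF assms(2)] base_change_def by auto
qed

lemma underlying_orientation_class:
  assumes "set bs \<subseteq> carrier_vec n"
  shows "underlying_subspace n (orientation_class n bs) = rspan n (set bs)"
proof -
  interpret vec_space "TYPE(real)" n .
  have "set cs \<subseteq> span (set bs)" if "cs \<in> orientation_class n bs" for cs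
    using that base_change_in_span[OF _ assms] by (auto simp: orientation_class_def)
  then have "span (\<Union>cs\<in>orientation_class n bs. set cs) \<subseteq> span (set bs)"
    using assms by (intro span_subsetI) auto
  moreover have "span (set bs) \<subseteq> span (\<Union>cs\<in>orientation_class n bs. set cs)"
    using orientation_class_self[OF assms] by (intro span_is_monotone) auto
  ultimately show ?thesis unfolding underlying_subspace_def by blast
qed

lemma negate_base_change:
  assumes "i < length bs" "set bs \<subseteq> carrier_vec n"
  shows "base_change n (multrow_mat (length bs) i (- 1)) bs (bs[i := - bs ! i])"
proof (rule base_changeI)
  have "- bs ! i \<in> carrier_vec n" using assms by auto
  then show "set (bs[i := - bs ! i]) \<subseteq> carrier_vec n"
    using assms(2) set_update_subset_insert by fastforce
  fix j r assume jr: "j < length bs" "r < n"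
  have c: "bs ! i \<in> carrier_vec n" using assms by auto
  have "(\<Sum>l<length bs. bs ! l $ r * multrow_mat (length bs) i (- 1) $$ (l, j))
    = (\<Sum>l<length bs. if l = j then (if i = j then - bs ! j $ r else bs ! j $ r) else 0)"
    using jr by (intro sum.cong) auto
  also have "\<dots> = (if i = j then - bs ! j $ r else bs ! j $ r)" using jr by simp
  finally show "bs[i := - bs ! i] ! j $ r =
    (\<Sum>l<length bs. bs ! l $ r * multrow_mat (length bs) i (- 1) $$ (l, j))"
    using jr assms c by (auto simp: nth_list_update)
qed auto

lemma mat_of_cols_map_mult:
  assumes "C \<in> carrier_mat n d" "set as \<subseteq> carrier_vec d"
  shows "mat_of_cols n (map ((*\<^sub>v) C) as) = C * mat_of_cols d as"
  using assms by (intro eq_matI) (auto simp: mat_of_cols_index subset_iff)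

section \<open>Bases adapted to oriented flags\<close>

text \<open>
  One step in the construction of bases adapted to a flag. The coordinates of \<open>pre @ post\<close>
  with respect to \<open>cs\<close> are independent and one vector short of a square matrix; a completing
  vector exists, and its sign can be chosen to make the determinant positive. The position of
  the new vector is left open, since the flag with initial spans needs it at the end and the
  one with final spans at the front.
\<close>
lemma adjoin_vector:
  assumes pp: "lin_indpt_list n (pre @ post)" and cs: "lin_indpt_list n cs"
    and len: "length cs = Suc (length (pre @ post))"
    and sub: "rspan n (set (pre @ post)) \<subseteq> rspan n (set cs)"
  shows "\<exists>x. pre @ x # post \<in> orientation_class n cs"
proof -
  let ?d = "length cs" and ?C = "mat_of_cols n cs"
  interpret vec_space "TYPE(real)" n .
  note car = lin_indpt_list_carrier[OF cs] lin_indpt_list_carrier[OF pp]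
  have "\<forall>b\<in>set (pre @ post). \<exists>a\<in>carrier_vec ?d. b = ?C *\<^sub>v a"
    using sub in_own_span[of "set (pre @ post)"] car unfolding rspan_eq[OF car(1)] by auto
  then obtain a where a: "\<And>b. b \<in> set (pre @ post) \<Longrightarrow> a b \<in> carrier_vec ?d \<and> ?C *\<^sub>v a b = b"
    by metis
  have C: "?C \<in> carrier_mat n ?d" by simp
  have map_a: "map ((*\<^sub>v) ?C) (map a pre) = pre" "map ((*\<^sub>v) ?C) (map a post) = post"
    using a by (auto simp: map_idI)
  have acar: "set (map a (pre @ post)) \<subseteq> carrier_vec ?d" using a by auto
  have "lin_indpt_list ?d (map a (pre @ post))"
    unfolding lin_indpt_list_iff
  proof (intro conjI ballI impI acar)
    fix c assume c: "c \<in> carrier_vec (length (map a (pre @ post)))"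
      "mat_of_cols ?d (map a (pre @ post)) *\<^sub>v c = 0\<^sub>v ?d"
    have "mat_of_cols n (pre @ post) = ?C * mat_of_cols ?d (map a (pre @ post))"
      using mat_of_cols_map_mult[OF C acar] map_a by simp
    then have "mat_of_cols n (pre @ post) *\<^sub>v c = ?C *\<^sub>v 0\<^sub>v ?d"
      using c assoc_mult_mat_vec[OF C mat_of_cols_carrier(1)[of ?d "map a (pre @ post)"] c(1)] by simp
    also have "\<dots> = 0\<^sub>v n" using C by auto
    finally show "c = 0\<^sub>v (length (map a (pre @ post)))"
      using pp c(1) unfolding lin_indpt_list_iff by auto
  qed
  then obtain y where "lin_indpt_list ?d (map a (pre @ post) @ [y])"
    using lin_indpt_list_extend[of ?d "map a (pre @ post)"] len by auto
  then have li: "lin_indpt_list ?d (map a pre @ y # map a post)"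
    by (subst lin_indpt_list_mset[of _ "map a (pre @ post) @ [y]"]) auto
  let ?as = "map a pre @ y # map a post"
  have "\<exists>y'. set (map a pre @ y' # map a post) \<subseteq> carrier_vec ?d \<and>
      0 < det (mat_of_cols ?d (map a pre @ y' # map a post))"
  proof (cases "0 < det (mat_of_cols ?d ?as)")
    case True
    then show ?thesis using lin_indpt_list_carrier[OF li] by blast
  next
    case False
    have ld: "length ?as = ?d" using len by simp
    then have neg: "det (mat_of_cols ?d ?as) < 0"
      using False li by (subst (asm) lin_indpt_list_square_iff) auto
    have bc: "base_change ?d (multrow_mat ?d (length pre) (- 1)) ?as (map a pre @ (- y) # map a post)"
      using negate_base_change[of "length pre" ?as ?d] lin_indpt_list_carrier[OF li] ld
      by (simp add: list_update_append nth_append)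
    then have "mat_of_cols ?d (map a pre @ (- y) # map a post) = mat_of_cols ?d ?as * multrow_mat ?d (length pre) (- 1)"
      unfolding base_change_def by blast
    moreover have "det (mat_of_cols ?d ?as * multrow_mat ?d (length pre) (- 1)) =
        det (mat_of_cols ?d ?as) * det (multrow_mat ?d (length pre) (- 1))"
      using mat_of_cols_carrier(1)[of ?d ?as] unfolding ld by (intro det_mult) auto
    moreover have "det (multrow_mat ?d (length pre) (- 1 :: real)) = - 1"
      using len by (intro det_multrow_mat) simp
    ultimately have "det (mat_of_cols ?d (map a pre @ (- y) # map a post)) = - det (mat_of_cols ?d ?as)"
      by simp
    then have "0 < det (mat_of_cols ?d (map a pre @ (- y) # map a post))" using neg by simp
    moreover have "set (map a pre @ (- y) # map a post) \<subseteq> carrier_vec ?d"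
      using bc unfolding base_change_def by blast
    ultimately show ?thesis by blast
  qed
  then obtain y' where y': "set (map a pre @ y' # map a post) \<subseteq> carrier_vec ?d"
    "0 < det (mat_of_cols ?d (map a pre @ y' # map a post))" by blast
  have "map ((*\<^sub>v) ?C) (map a pre @ y' # map a post) = pre @ (?C *\<^sub>v y') # post"
    using map_a by simp
  moreover have "base_change n (mat_of_cols ?d (map a pre @ y' # map a post)) cs
      (map ((*\<^sub>v) ?C) (map a pre @ y' # map a post))"
    unfolding base_change_def
  proof (intro conjI)
    show "set (map ((*\<^sub>v) ?C) (map a pre @ y' # map a post)) \<subseteq> carrier_vec n"
      using y'(1) C by (auto intro!: mult_mat_vec_carrier[OF C])
  qed (use len in \<open>simp_all add: carrier_matI mat_of_cols_map_mult[OF C y'(1)] del: map_append list.map\<close>)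
  ultimately show ?thesis using y'(2) unfolding orientation_class_def by auto
qed

lemma initial_flag_basis:
  assumes "\<And>i. i \<le> m \<Longrightarrow> f i \<in> oriented_subspaces n i"
    and "\<And>i. i < m \<Longrightarrow> underlying_subspace n (f i) \<subseteq> underlying_subspace n (f (Suc i))"
  shows "\<exists>B. length B = m \<and> lin_indpt_list n B \<and> (\<forall>i\<le>m. f i = orientation_class n (take i B))"
  using assms
proof (induction m)
  case 0
  then show ?case by (auto simp: oriented_subspaces_def lin_indpt_list_iff)
next
  case (Suc m)
  then obtain B where B: "length B = m" "lin_indpt_list n B"
    "\<forall>i\<le>m. f i = orientation_class n (take i B)" by auto
  obtain cs where cs: "lin_indpt_list n cs" "length cs = Suc m" "f (Suc m) = orientation_class n cs"
    using Suc.prems(1)[of "Suc m"] by (auto simp: oriented_subspaces_def)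
  have "rspan n (set B) \<subseteq> rspan n (set cs)"
    using Suc.prems(2)[of m] B cs
    by (simp add: underlying_orientation_class lin_indpt_list_carrier)
  then obtain x where x: "B @ [x] \<in> orientation_class n cs"
    using adjoin_vector[of n B "[]" cs] B cs by auto
  then have "lin_indpt_list n (B @ [x])" using cs lin_indpt_list_orientation_class by blast
  moreover have "f (Suc m) = orientation_class n (B @ [x])"
    using orientation_class_eq[OF x] cs lin_indpt_list_carrier by blast
  ultimately show ?case using B by (intro exI[of _ "B @ [x]"]) (auto simp: le_Suc_eq)
qed

lemma final_flag_basis:
  assumes "\<And>i. i \<le> m \<Longrightarrow> f i \<in> oriented_subspaces n i"
    and "\<And>i. i < m \<Longrightarrow> underlying_subspace n (f i) \<subseteq> underlying_subspace n (f (Suc i))"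
  shows "\<exists>B. length B = m \<and> lin_indpt_list n B \<and> (\<forall>i\<le>m. f i = orientation_class n (drop (m - i) B))"
  using assms
proof (induction m)
  case 0
  then show ?case by (auto simp: oriented_subspaces_def lin_indpt_list_iff)
next
  case (Suc m)
  then obtain B where B: "length B = m" "lin_indpt_list n B"
    "\<forall>i\<le>m. f i = orientation_class n (drop (m - i) B)" by auto
  obtain cs where cs: "lin_indpt_list n cs" "length cs = Suc m" "f (Suc m) = orientation_class n cs"
    using Suc.prems(1)[of "Suc m"] by (auto simp: oriented_subspaces_def)
  have "rspan n (set B) \<subseteq> rspan n (set cs)"
    using Suc.prems(2)[of m] B cs
    by (simp add: underlying_orientation_class lin_indpt_list_carrier)
  then obtain x where x: "x # B \<in> orientation_class n cs"
    using adjoin_vector[of n "[]" B cs] B cs by auto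
  then have "lin_indpt_list n (x # B)" using cs lin_indpt_list_orientation_class by blast
  moreover have "f (Suc m) = orientation_class n (x # B)"
    using orientation_class_eq[OF x] cs lin_indpt_list_carrier by blast
  ultimately show ?case using B by (intro exI[of _ "x # B"]) (auto simp: le_Suc_eq Suc_diff_le)
qed

lemma unit_vecs_standard: "unit_vecs n \<in> standard_orientation n"
  unfolding standard_orientation_def by (rule orientation_class_self[OF unit_vecs_carrier])

lemma standard_orientation_lin_indpt: "B \<in> standard_orientation n \<Longrightarrow> lin_indpt_list n B"
  by (auto simp: mem_standard_orientation_iff lin_indpt_list_square_iff)

lemma orientation_class_standard:
  "B \<in> standard_orientation n \<Longrightarrow> orientation_class n B = standard_orientation n"
  unfolding standard_orientation_def by (rule orientation_class_eq[OF _ unit_vecs_carrier])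

text \<open>
  A lift stops at dimension \<open>n - 1\<close>; continued by the whole space with its standard
  orientation, it yields bases of the whole space.
\<close>
lemma flag_lift_extended:
  assumes "f \<in> flag_lifts n"
  defines "g \<equiv> f(n := standard_orientation n)"
  shows "\<And>i. i \<le> n \<Longrightarrow> g i \<in> oriented_subspaces n i"
    and "\<And>i. i < n \<Longrightarrow> underlying_subspace n (g i) \<subseteq> underlying_subspace n (g (Suc i))"
proof -
  interpret vec_space "TYPE(real)" n .
  have top: "standard_orientation n \<in> oriented_subspaces n n"
    using standard_orientation_lin_indpt[OF unit_vecs_standard] orientation_class_standard[OF unit_vecs_standard]
    unfolding oriented_subspaces_def by force
  show g: "g i \<in> oriented_subspaces n i" if "i \<le> n" for i
    using that assms(1) top by (auto simp: g_def flag_lifts_def)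
  fix i assume i: "i < n"
  show "underlying_subspace n (g i) \<subseteq> underlying_subspace n (g (Suc i))"
  proof (cases "Suc i = n")
    case True
    obtain bs where bs: "lin_indpt_list n bs" "g i = orientation_class n bs"
      using g[of i] i by (auto simp: oriented_subspaces_def)
    have "underlying_subspace n (g i) \<subseteq> carrier_vec n"
      using bs span_is_subset2[of "set bs"] by (simp add: underlying_orientation_class lin_indpt_list_carrier)
    also have "\<dots> = underlying_subspace n (g (Suc i))"
      using True by (simp add: g_def standard_orientation_def underlying_orientation_class[OF unit_vecs_carrier]
          span_unit_vecs_is_carrier)
    finally show ?thesis .
  qed (use i assms(1) in \<open>auto simp: g_def flag_lifts_def\<close>)
qed

lemma flag_lift_eq_initial_lift:
  assumes "f \<in> flag_lifts n"
  shows "\<exists>B\<in>standard_orientation n. f = initial_lift n B"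
proof -
  obtain B where B: "length B = n" "lin_indpt_list n B"
    "\<And>i. i \<le> n \<Longrightarrow> (f(n := standard_orientation n)) i = orientation_class n (take i B)"
    using initial_flag_basis[of n "f(n := standard_orientation n)", OF flag_lift_extended[OF assms]] by blast
  have "f = initial_lift n B"
  proof
    fix i show "f i = initial_lift n B i"
      using B(3)[of i] assms by (cases "i < n") (auto simp: initial_lift_def flag_lifts_def)
  qed
  moreover have "B \<in> standard_orientation n"
    using B(1) B(3)[of n] orientation_class_self[OF lin_indpt_list_carrier[OF B(2)]] by simp
  ultimately show ?thesis by blast
qed

lemma flag_lift_eq_final_lift:
  assumes "f \<in> flag_lifts n"
  shows "\<exists>B\<in>standard_orientation n. f = final_lift n B"
proof -
  obtain B where B: "length B = n" "lin_indpt_list n B"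
    "\<And>i. i \<le> n \<Longrightarrow> (f(n := standard_orientation n)) i = orientation_class n (drop (n - i) B)"
    using final_flag_basis[of n "f(n := standard_orientation n)", OF flag_lift_extended[OF assms]] by blast
  have "f = final_lift n B"
  proof
    fix i show "f i = final_lift n B i"
      using B(3)[of i] assms by (cases "i < n") (auto simp: final_lift_def flag_lifts_def)
  qed
  moreover have "B \<in> standard_orientation n"
    using B(1) B(3)[of n] orientation_class_self[OF lin_indpt_list_carrier[OF B(2)]] by simp
  ultimately show ?thesis by blast
qed

lemma initial_lift_in_flag_lifts:
  assumes "B \<in> standard_orientation n"
  shows "initial_lift n B \<in> flag_lifts n"
proof -
  interpret vec_space "TYPE(real)" n .
  note B = standard_orientation_lin_indpt[OF assms]
  have li: "lin_indpt_list n (take i B)" for i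
    using B by (intro lin_indpt_list_sublist[OF B] set_take_subset distinct_take) (simp add: lin_indpt_list_def)
  have len: "length B = n" using assms by (simp add: mem_standard_orientation_iff)
  have "span (set (take i B)) \<subseteq> span (set (take (Suc i) B))" for i
    by (intro span_is_monotone set_take_subset_set_take) simp
  then show ?thesis
    using li len unfolding flag_lifts_def initial_lift_def
    by (auto simp: oriented_subspaces_def underlying_orientation_class lin_indpt_list_carrier min_def)
qed

lemma final_lift_in_flag_lifts:
  assumes "B \<in> standard_orientation n"
  shows "final_lift n B \<in> flag_lifts n"
proof -
  interpret vec_space "TYPE(real)" n .
  note B = standard_orientation_lin_indpt[OF assms]
  have li: "lin_indpt_list n (drop i B)" for i
    using B by (intro lin_indpt_list_sublist[OF B] set_drop_subset distinct_drop) (simp add: lin_indpt_list_def)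
  have len: "length B = n" using assms by (simp add: mem_standard_orientation_iff)
  have "span (set (drop (n - i) B)) \<subseteq> span (set (drop (n - Suc i) B))" for i
    by (intro span_is_monotone set_drop_subset_set_drop) simp
  then show ?thesis
    using li len unfolding flag_lifts_def final_lift_def
    by (auto simp: oriented_subspaces_def underlying_orientation_class lin_indpt_list_carrier
        intro!: exI[of _ "drop (length B - _) B"])
qed

section \<open>Oriented flags as classes of lifts\<close>

lemma reverse_orientation_base_change:
  assumes "cs \<in> reverse_orientation n (orientation_class n bs)"
  obtains A where "base_change n A bs cs" "det A < 0"
proof -
  obtain bs' A B where "base_change n A bs bs'" "0 < det A" "base_change n B bs' cs" "det B < 0"
    using assms unfolding reverse_orientation_def orientation_class_def by auto
  then show ?thesis
    using base_change_trans[of n A bs bs' B cs] det_mult[of A "length bs" B]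
    by (intro that[of "A * B"]) (auto simp: base_change_def mult_pos_neg)
qed

lemma underlying_reverse_orientation_subset:
  assumes "set bs \<subseteq> carrier_vec n"
  shows "underlying_subspace n (reverse_orientation n (orientation_class n bs)) \<subseteq> rspan n (set bs)"
proof -
  interpret vec_space "TYPE(real)" n .
  have "set cs \<subseteq> span (set bs)" if "cs \<in> reverse_orientation n (orientation_class n bs)" for cs
    using reverse_orientation_base_change[OF that] base_change_in_span[OF _ assms] by metis
  then show ?thesis unfolding underlying_subspace_def using assms by (intro span_subsetI) auto
qed

lemma reverse_orientation_twice:
  assumes "bs \<noteq> []" "set bs \<subseteq> carrier_vec n"
  shows "reverse_orientation n (reverse_orientation n (orientation_class n bs)) = orientation_class n bs"
proof
  show "reverse_orientation n (reverse_orientation n (orientation_class n bs)) \<subseteq> orientation_class n bs"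
  proof
    fix ds assume "ds \<in> reverse_orientation n (reverse_orientation n (orientation_class n bs))"
    then obtain cs B where cs: "cs \<in> reverse_orientation n (orientation_class n bs)"
      and B: "base_change n B cs ds" "det B < 0" unfolding reverse_orientation_def[of n "reverse_orientation _ _"] by blast
    obtain A where A: "base_change n A bs cs" "det A < 0" using reverse_orientation_base_change[OF cs] .
    have "det (A * B) = det A * det B" using A B by (intro det_mult[of _ "length bs"]) (auto simp: base_change_def)
    then show "ds \<in> orientation_class n bs"
      using base_change_trans[OF A(1) B(1)] A(2) B(2) mult_neg_neg[of "det A" "det B"]
      unfolding orientation_class_def by auto
  qed
  show "orientation_class n bs \<subseteq> reverse_orientation n (reverse_orientation n (orientation_class n bs))"
  proof
    fix ds assume ds: "ds \<in> orientation_class n bs"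
    have l: "0 < length ds" "set ds \<subseteq> carrier_vec n"
      using orientation_class_length[OF ds] orientation_class_carrier[OF ds] assms by auto
    let ?D = "multrow_mat (length ds) 0 (- 1 :: real)"
    have D: "base_change n ?D ds (ds[0 := - ds ! 0])" "det ?D = - 1"
      using negate_base_change[OF l] det_multrow_mat[OF l(1), of "- 1 :: real"] by auto
    obtain D' where D': "base_change n D' (ds[0 := - ds ! 0]) ds" "det ?D * det D' = 1"
      using base_change_inverse[OF D(1) _ l(2)] D(2) by auto
    have "ds[0 := - ds ! 0] \<in> reverse_orientation n (orientation_class n bs)"
      using D ds unfolding reverse_orientation_def by (intro CollectI bexI[OF _ ds] exI[of _ ?D]) simp
    moreover have "det D' < 0" using D D'(2) by simp
    ultimately show "ds \<in> reverse_orientation n (reverse_orientation n (orientation_class n bs))"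
      using D'(1) unfolding reverse_orientation_def[of n "reverse_orientation _ _"] by blast
  qed
qed

lemma reverse_odd_twice:
  assumes "f \<in> flag_lifts n"
  shows "reverse_odd n (reverse_odd n f) = f"
proof
  fix i
  show "reverse_odd n (reverse_odd n f) i = f i"
  proof (cases "i < n")
    case True
    then obtain bs where bs: "f i = orientation_class n bs" "lin_indpt_list n bs" "length bs = i"
      using assms by (auto simp: flag_lifts_def oriented_subspaces_def)
    then show ?thesis
      using reverse_orientation_twice[of bs n] lin_indpt_list_carrier[OF bs(2)]
      by (cases "i = 0") (auto simp: reverse_odd_def)
  next
    case False
    then have "f i = {}" using assms by (simp add: flag_lifts_def)
    then show ?thesis by (simp add: reverse_odd_def reverse_orientation_def)
  qed
qed

text \<open>
  Symmetry and transitivity both come from the fact that reversing the odd-dimensional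
  orientations twice changes nothing.
\<close>
lemma equiv_lift_rel: "equiv (flag_lifts n) (lift_rel n)"
proof (rule equivI)
  show "sym (lift_rel n)" unfolding sym_def lift_rel_def using reverse_odd_twice by auto
  show "trans (lift_rel n)" unfolding trans_def lift_rel_def using reverse_odd_twice by auto
qed (auto simp: refl_on_def lift_rel_def)

lemma Flag_plus_class:
  assumes "F \<in> Flag_plus n" "f \<in> F"
  shows "f \<in> flag_lifts n" "F = lift_rel n `` {f}"
proof -
  obtain g where g: "g \<in> flag_lifts n" "F = lift_rel n `` {g}"
    using assms(1) by (auto simp: Flag_plus_def elim: quotientE)
  then have "(g, f) \<in> lift_rel n" using assms(2) by simp
  then show "f \<in> flag_lifts n" "F = lift_rel n `` {f}"
    using g equiv_class_eq[OF equiv_lift_rel] by (auto simp: lift_rel_def)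
qed

lemma lift_rel_class:
  assumes "f \<in> flag_lifts n"
  shows "f \<in> lift_rel n `` {f}" "lift_rel n `` {f} \<in> Flag_plus n"
  using assms quotientI[OF assms, of "lift_rel n"] by (auto simp: lift_rel_def Flag_plus_def)

section \<open>Adapted bases of transverse pairs\<close>

lemma mat_of_cols_square: "length bs = n \<Longrightarrow> mat_of_cols n bs \<in> carrier_mat n n"
  using mat_of_cols_carrier(1) by blast

lemma mult_mat_vec_bij:
  assumes "A \<in> carrier_mat n n" "det (A :: real mat) \<noteq> 0" "v \<in> carrier_vec n"
  shows "\<exists>!c. c \<in> carrier_vec n \<and> A *\<^sub>v c = v"
proof -
  from det_non_zero_imp_unit[OF assms(1,2), of class_ring]
  obtain B where B: "B \<in> carrier_mat n n" "A * B = 1\<^sub>m n" "B * A = 1\<^sub>m n"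
    unfolding Units_def ring_mat_def by auto
  show ?thesis
  proof (rule ex1I[of _ "B *\<^sub>v v"])
    have "A *\<^sub>v (B *\<^sub>v v) = (A * B) *\<^sub>v v"
      using assms B by (intro assoc_mult_mat_vec[symmetric])
    then show "B *\<^sub>v v \<in> carrier_vec n \<and> A *\<^sub>v (B *\<^sub>v v) = v" using B assms by simp
    fix c assume c: "c \<in> carrier_vec n \<and> A *\<^sub>v c = v"
    then have "(B * A) *\<^sub>v c = B *\<^sub>v v"
      using assoc_mult_mat_vec[OF B(1) assms(1), of c] by metis
    then show "c = B *\<^sub>v v" using c unfolding B(3) by (metis one_mult_mat_vec)
  qed
qed

text \<open>
  The lines \<open>F\<^sub>1\<^sup>(\<^sup>i\<^sup>+\<^sup>1\<^sup>) \<inter> F\<^sub>2\<^sup>(\<^sup>n\<^sup>-\<^sup>i\<^sup>)\<close> must carry the adapted basis. Since the first \<open>i\<close>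
  vectors of \<open>B\<close> and the last \<open>n - i\<close> vectors of \<open>C\<close> form a basis, \<open>B ! i\<close> has an expansion in
  it, and the part of it in \<open>C\<close> is a vector of this line. It differs from \<open>B ! i\<close> by earlier
  vectors of \<open>B\<close>, so the first flag keeps its orientation; for the second flag, the leading
  coefficient is positive by Cramer's rule, being a quotient of two consecutive positive
  determinants.
\<close>
lemma adapted_basis_exists:
  assumes B: "B \<in> standard_orientation n" and C: "C \<in> standard_orientation n"
    and transverse: "\<And>i. 1 \<le> i \<Longrightarrow> i < n \<Longrightarrow> take i B @ drop i C \<in> standard_orientation n"
  shows "\<exists>E\<in>standard_orientation n. initial_lift n E = initial_lift n B \<and> final_lift n E = final_lift n C"
proof -
  define M where "M i = mat_of_cols n (take i B @ drop i C)" for i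
  have len: "length B = n" "length C = n" and car: "set B \<subseteq> carrier_vec n" "set C \<subseteq> carrier_vec n"
    using B C by (auto simp: mem_standard_orientation_iff)
  have M: "M i \<in> carrier_mat n n" "0 < det (M i)" if "i \<le> n" for i
  proof -
    have "take i B @ drop i C \<in> standard_orientation n"
      using transverse[of i] B C len that by (cases "i = 0"; cases "i = n") auto
    then show "M i \<in> carrier_mat n n" "0 < det (M i)"
      using that unfolding M_def mem_standard_orientation_iff by (auto simp: mat_of_cols_square)
  qed
  have "\<exists>x. x \<in> carrier_vec n \<and> M i *\<^sub>v x = B ! i" if "i < n" for i
  proof -
    have "B ! i \<in> carrier_vec n" using car(1) len that by auto
    then show ?thesis using mult_mat_vec_bij[OF M(1)[of i], of "B ! i"] M(2)[of i] that by auto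
  qed
  then obtain x where x: "\<And>i. i < n \<Longrightarrow> x i \<in> carrier_vec n \<and> M i *\<^sub>v x i = B ! i" by metis
  have B_expand: "B ! i $ r = (\<Sum>l<i. B ! l $ r * x i $ l) + (\<Sum>l\<in>{i..<n}. C ! l $ r * x i $ l)"
    if "i < n" "r < n" for i r
  proof -
    have "B ! i $ r = (M i *\<^sub>v x i) $ r" using x that by simp
    also have "\<dots> = (\<Sum>l\<in>{0..<n}. M i $$ (r, l) * x i $ l)"
      using M(1)[of i] conjunct1[OF x[of i]] that by (auto simp: scalar_prod_def)
    also have "{0..<n} = {..<i} \<union> {i..<n}" using that by auto
    also have "(\<Sum>l\<in>{..<i} \<union> {i..<n}. M i $$ (r, l) * x i $ l) =
        (\<Sum>l<i. M i $$ (r, l) * x i $ l) + (\<Sum>l\<in>{i..<n}. M i $$ (r, l) * x i $ l)"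
      by (rule sum.union_disjoint) auto
    also have "\<dots> = (\<Sum>l<i. B ! l $ r * x i $ l) + (\<Sum>l\<in>{i..<n}. C ! l $ r * x i $ l)"
      using that len by (intro arg_cong2[where f = "(+)"] sum.cong)
        (auto simp: M_def mat_of_cols_index nth_append)
    finally show ?thesis .
  qed
  have x_pos: "0 < x i $ i" if "i < n" for i
  proof -
    have "replace_col (M i) (M i *\<^sub>v x i) i = M (Suc i)"
      using that len x[of i] car by (intro eq_matI)
        (auto simp: M_def replace_col_def mat_of_cols_index nth_append less_Suc_eq)
    then have "det (M (Suc i)) = x i $ i * det (M i)"
      using cramer_lemma_mat[OF M(1)[of i], of "x i" i] x[of i] that by simp
    then show ?thesis using M(2)[of i] M(2)[of "Suc i"] that by (simp add: zero_less_mult_iff)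
  qed
  define E where "E = map (\<lambda>i. vec n (\<lambda>r. \<Sum>l\<in>{i..<n}. C ! l $ r * x i $ l)) [0..<n]"
  have E: "length E = n" "set E \<subseteq> carrier_vec n" by (auto simp: E_def)
  have E_C: "E ! i $ r = (\<Sum>l\<in>{i..<n}. C ! l $ r * x i $ l)" if "i < n" "r < n" for i r
    using that by (simp add: E_def)
  have initial: "orientation_class n (take i E) = orientation_class n (take i B)" if "i \<le> n" for i
  proof -
    define A where "A = mat i i (\<lambda>(l, j). if l < j then - x j $ l else if l = j then 1 else 0)"
    have "base_change n A (take i B) (take i E)"
    proof (rule base_changeI)
      show "set (take i E) \<subseteq> carrier_vec n" using E(2) set_take_subset by fast
      fix j r assume "j < length (take i B)" "r < n"
      then have j: "j < i" "j < n" "r < n" using that len by auto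
      have "(\<Sum>l<length (take i B). take i B ! l $ r * A $$ (l, j)) = (\<Sum>l<Suc j. B ! l $ r * A $$ (l, j))"
        using j that len by (intro sum.mono_neutral_cong_right) (auto simp: A_def)
      also have "\<dots> = B ! j $ r - (\<Sum>l<j. B ! l $ r * x j $ l)"
        using j by (simp add: A_def sum_negf)
      also have "\<dots> = E ! j $ r" using B_expand[of j r] E_C[of j r] j by simp
      finally show "take i E ! j $ r = (\<Sum>l<length (take i B). take i B ! l $ r * A $$ (l, j))"
        using j by simp
    qed (use that len E in \<open>auto simp: A_def\<close>)
    moreover have "det A = 1"
      by (subst det_upper_triangular[of _ i])
        (auto simp: A_def diag_mat_def upper_triangular_def simp flip: prod.distinct_set_conv_list)
    moreover have "set (take i B) \<subseteq> carrier_vec n" using car(1) set_take_subset by fast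
    ultimately show ?thesis by (intro orientation_class_base_change[of n A]) auto
  qed
  have final: "orientation_class n (drop i E) = orientation_class n (drop i C)" if "i \<le> n" for i
  proof -
    define A where "A = mat (n - i) (n - i) (\<lambda>(l, j). if j \<le> l then x (i + j) $ (i + l) else 0)"
    have "base_change n A (drop i C) (drop i E)"
    proof (rule base_changeI)
      show "set (drop i E) \<subseteq> carrier_vec n" using E(2) set_drop_subset by fast
      fix j r assume "j < length (drop i C)" "r < n"
      then have j: "i + j < n" "r < n" using that len by auto
      have "(\<Sum>l<length (drop i C). drop i C ! l $ r * A $$ (l, j)) =
          (\<Sum>l\<in>{j..<n - i}. C ! (i + l) $ r * x (i + j) $ (i + l))"
        using j that len by (intro sum.mono_neutral_cong_right) (auto simp: A_def)
      also have "\<dots> = (\<Sum>l\<in>{i + j..<n}. C ! l $ r * x (i + j) $ l)"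
        by (rule sum.reindex_bij_witness[of _ "\<lambda>l. l - i" "\<lambda>l. i + l"]) auto
      finally show "drop i E ! j $ r = (\<Sum>l<length (drop i C). drop i C ! l $ r * A $$ (l, j))"
        using j E_C[of "i + j" r] E by simp
    qed (use that len E in \<open>auto simp: A_def\<close>)
    moreover have "det A = (\<Prod>j<n - i. x (i + j) $ (i + j))"
      by (subst det_lower_triangular[of "n - i"])
        (auto simp: A_def diag_mat_def atLeast0LessThan simp flip: prod.distinct_set_conv_list)
    then have "0 < det A" using x_pos by (auto intro: prod_pos)
    moreover have "set (drop i C) \<subseteq> carrier_vec n" using car(2) set_drop_subset by fast
    ultimately show ?thesis by (intro orientation_class_base_change[of n A]) auto
  qed
  have "E \<in> standard_orientation n"
    using initial[of n] E len orientation_class_self[OF E(2)] orientation_class_standard[OF B] by simp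
  then show ?thesis using initial final unfolding initial_lift_def final_lift_def
    by (intro bexI[of _ E] conjI ext) simp_all
qed

section \<open>Flags in the coordinates of an adapted basis\<close>

text \<open>
  The list of the vectors whose coordinates with respect to \<open>E\<close> are the columns of \<open>w\<close>.
\<close>
definition frame :: "nat \<Rightarrow> real vec list \<Rightarrow> (nat \<Rightarrow> nat \<Rightarrow> real) \<Rightarrow> real vec list" where
  "frame n E w = map (\<lambda>j. mat_of_cols n E *\<^sub>v vec n (w j)) [0..<n]"

lemma length_frame [simp]: "length (frame n E w) = n"
  by (simp add: frame_def)

lemma set_frame:
  assumes "length E = n"
  shows "set (frame n E w) \<subseteq> carrier_vec n"
proof -
  have "mat_of_cols n E *\<^sub>v vec n (w j) \<in> carrier_vec n" for j
    by (rule mult_mat_vec_carrier[OF mat_of_cols_square[OF assms]]) simp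
  then show ?thesis by (auto simp: frame_def)
qed

lemma frame_exists:
  assumes E: "E \<in> standard_orientation n" and B: "B \<in> standard_orientation n"
  shows "\<exists>w. B = frame n E w"
proof -
  have "\<exists>c. c \<in> carrier_vec n \<and> mat_of_cols n E *\<^sub>v c = B ! j" if "j < n" for j
  proof -
    have "mat_of_cols n E \<in> carrier_mat n n" "det (mat_of_cols n E) \<noteq> 0" "B ! j \<in> carrier_vec n"
      using E B that by (auto simp: mem_standard_orientation_iff mat_of_cols_square)
    from mult_mat_vec_bij[OF this] show ?thesis by blast
  qed
  then obtain c where c: "\<And>j. j < n \<Longrightarrow> c j \<in> carrier_vec n \<and> mat_of_cols n E *\<^sub>v c j = B ! j" by metis
  have "vec n (($) (c j)) = c j" if "j < n" for j using c[OF that] by auto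
  then have "B = frame n E (\<lambda>j. ($) (c j))"
    using c B by (intro nth_equalityI) (auto simp: frame_def mem_standard_orientation_iff)
  then show ?thesis by blast
qed

text \<open>
  With respect to \<open>E\<close>, the list consists of unit vectors except for \<open>i2\<close> columns of \<open>w\<close> in the
  middle, and expansion along the unit vectors leaves the rows \<open>i1, \<dots>, i1 + i2 - 1\<close> of these
  columns.
\<close>
lemma det_frame_minor:
  assumes E: "length E = n" "set E \<subseteq> carrier_vec n" and le: "i1 + i2 \<le> n"
  shows "det (mat_of_cols n (take i1 E @ take i2 (frame n E w) @ drop (i1 + i2) E)) =
    det (mat_of_cols n E) * initial_minor w i1 i2"
proof -
  define N where "N = mat n n (\<lambda>(r, j). if j < i1 \<or> i1 + i2 \<le> j then of_bool (r = j) else w (j - i1) r)"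
  have M: "mat_of_cols n E \<in> carrier_mat n n" using E by (simp add: mat_of_cols_square)
  have N: "N \<in> carrier_mat n n" by (simp add: N_def)
  have "take i1 E @ take i2 (frame n E w) @ drop (i1 + i2) E = map ((*\<^sub>v) (mat_of_cols n E)) (cols N)"
  proof (rule nth_equalityI)
    fix j assume "j < length (take i1 E @ take i2 (frame n E w) @ drop (i1 + i2) E)"
    then have j: "j < n" using le E by auto
    show "(take i1 E @ take i2 (frame n E w) @ drop (i1 + i2) E) ! j =
      map ((*\<^sub>v) (mat_of_cols n E)) (cols N) ! j"
    proof (cases "j < i1 \<or> i1 + i2 \<le> j")
      case True
      then have "col N j = unit_vec n j" using j by (auto simp: N_def)
      then have "map ((*\<^sub>v) (mat_of_cols n E)) (cols N) ! j = E ! j"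
        using j N mat_mult_unit_vec[OF M j] E by (simp add: subset_iff)
      then show ?thesis using True j le E by (auto simp: nth_append)
    next
      case False
      then have "col N j = vec n (w (j - i1))" using j by (auto simp: N_def)
      then have "map ((*\<^sub>v) (mat_of_cols n E)) (cols N) ! j = mat_of_cols n E *\<^sub>v vec n (w (j - i1))"
        using j N by simp
      then show ?thesis using False j le E by (auto simp: nth_append frame_def)
    qed
  qed (use le E N in auto)
  then have "mat_of_cols n (take i1 E @ take i2 (frame n E w) @ drop (i1 + i2) E) = mat_of_cols n E * N"
    using mat_of_cols_map_mult[OF M, of "cols N"] N mat_of_cols_cols[of N] cols_dim[of N] by auto
  moreover have "det N = initial_minor w i1 i2"
  proof -
    let ?i3 = "n - (i1 + i2)"
    let ?W = "mat i2 i2 (\<lambda>(r, c). w c (i1 + r))"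
    let ?U = "four_block_mat (1\<^sub>m i1) (mat i1 i2 (\<lambda>(r, c). w c r)) (0\<^sub>m i2 i1) ?W"
    have "N = four_block_mat ?U (0\<^sub>m (i1 + i2) ?i3)
        (mat ?i3 (i1 + i2) (\<lambda>(r, j). if j < i1 then 0 else w (j - i1) (i1 + i2 + r))) (1\<^sub>m ?i3)"
      using le by (intro eq_matI) (auto simp: N_def)
    then have "det N = det ?U * det (1\<^sub>m ?i3)"
      by (simp only:) (rule det_four_block_mat_upper_right_zero[of _ "i1 + i2" _ ?i3], auto)
    also have "det ?U = det (1\<^sub>m i1) * det ?W"
      by (rule det_four_block_mat_lower_left_zero[of _ i1 _ i2]) auto
    finally show ?thesis by (simp add: initial_minor_def)
  qed
  ultimately show ?thesis using det_mult[OF M N] by simp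
qed

lemma frame_combination:
  assumes "length E = n" "k \<le> n"
  shows "mat_of_cols n (take k (frame n E w)) *\<^sub>v vec k c =
    mat_of_cols n E *\<^sub>v vec n (\<lambda>i. \<Sum>j<k. c j * w j i)"
proof -
  have M: "mat_of_cols n E \<in> carrier_mat n n" using assms by (simp add: mat_of_cols_square)
  let ?W = "map (\<lambda>j. vec n (w j)) [0..<k]"
  have "take k (frame n E w) = map ((*\<^sub>v) (mat_of_cols n E)) ?W"
    using assms(2) by (simp add: frame_def take_map)
  then have "mat_of_cols n (take k (frame n E w)) = mat_of_cols n E * mat_of_cols n ?W"
    using mat_of_cols_map_mult[OF M, of ?W] by (simp add: image_subset_iff)
  then have "mat_of_cols n (take k (frame n E w)) *\<^sub>v vec k c = mat_of_cols n E *\<^sub>v (mat_of_cols n ?W *\<^sub>v vec k c)"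
    using assoc_mult_mat_vec[OF M, of "mat_of_cols n ?W" k "vec k c"] mat_of_cols_carrier(1)[of n ?W] by simp
  also have "mat_of_cols n ?W *\<^sub>v vec k c = vec n (\<lambda>i. \<Sum>j<k. c j * w j i)"
    by (intro eq_vecI) (auto simp: scalar_prod_def mat_of_cols_index atLeast0LessThan mult.commute)
  finally show ?thesis .
qed

lemma oriented_sum_lifts_iff:
  assumes "B1 \<in> standard_orientation n" "B2 \<in> standard_orientation n" "B3 \<in> standard_orientation n"
    and "i1 < n" "i2 < n" "i3 < n"
  shows "oriented_sum n (oriented_sum n (initial_lift n B1 i1) (initial_lift n B2 i2)) (final_lift n B3 i3)
      = standard_orientation n \<longleftrightarrow>
    take i1 B1 @ take i2 B2 @ drop (n - i3) B3 \<in> standard_orientation n"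
proof -
  have "set (take i1 B1) \<subseteq> carrier_vec n" "set (take i2 B2) \<subseteq> carrier_vec n"
    "set (drop (n - i3) B3) \<subseteq> carrier_vec n"
    using assms(1-3) set_take_subset[of i1 B1] set_take_subset[of i2 B2] set_drop_subset[of "n - i3" B3]
    unfolding mem_standard_orientation_iff by blast+
  then show ?thesis using assms(4-6)
    by (simp add: initial_lift_def final_lift_def oriented_sum_orientation_class
        orientation_class_eq_standard_iff)
qed

lemma frame_minor_iff:
  assumes "E \<in> standard_orientation n" "i1 + i2 \<le> n"
  shows "take i1 E @ take i2 (frame n E w) @ drop (i1 + i2) E \<in> standard_orientation n \<longleftrightarrow>
    0 < initial_minor w i1 i2"
proof -
  have E: "length E = n" "set E \<subseteq> carrier_vec n" "0 < det (mat_of_cols n E)"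
    using assms(1) by (auto simp: mem_standard_orientation_iff)
  have "set (take i1 E @ take i2 (frame n E w) @ drop (i1 + i2) E) \<subseteq> carrier_vec n"
    using E(2) set_frame[OF E(1), of w] set_take_subset[of i1 E] set_take_subset[of i2 "frame n E w"]
      set_drop_subset[of "i1 + i2" E] by auto
  moreover have "length (take i1 E @ take i2 (frame n E w) @ drop (i1 + i2) E) = n"
    using E(1) assms(2) by simp
  ultimately show ?thesis
    using det_frame_minor[OF E(1,2) assms(2), of w] E(3)
    unfolding mem_standard_orientation_iff by (simp add: zero_less_mult_iff)
qed

lemma coordinates_mult:
  assumes "E \<in> standard_orientation n" "c \<in> carrier_vec n"
  shows "coordinates n E (mat_of_cols n E *\<^sub>v c) = c"
proof -
  have M: "mat_of_cols n E \<in> carrier_mat n n" "det (mat_of_cols n E) \<noteq> 0"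
    using assms(1) by (auto simp: mem_standard_orientation_iff mat_of_cols_square)
  from mult_mat_vec_bij[OF M, of "mat_of_cols n E *\<^sub>v c"] M(1) assms(2) show ?thesis
    unfolding coordinates_def by (intro the1_equality) auto
qed

lemma S_plus_le_iff:
  assumes "E \<in> standard_orientation n" "0 < n"
  shows "S_plus n E (mat_of_cols n E *\<^sub>v vec n u) \<le> m \<longleftrightarrow>
    (\<forall>\<sigma>\<in>{1, -1}. alternations \<sigma> (map u [0..<n]) \<le> Suc m)"
  using Max_sign_changes_le_iff[of "vec n u" m] assms coordinates_mult[OF assms(1), of "vec n u"]
  unfolding S_plus_def by simp

lemma flag_subspace_class:
  assumes B: "B \<in> standard_orientation n" and "i < n"
  shows "flag_subspace n (lift_rel n `` {initial_lift n B}) i = rspan n (set (take i B))"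
proof
  have car: "set (take i B) \<subseteq> carrier_vec n"
    using B set_take_subset[of i B] unfolding mem_standard_orientation_iff by blast
  have u: "underlying_subspace n (initial_lift n B i) = rspan n (set (take i B))"
    using underlying_orientation_class[OF car] \<open>i < n\<close> by (simp add: initial_lift_def)
  then show "rspan n (set (take i B)) \<subseteq> flag_subspace n (lift_rel n `` {initial_lift n B}) i"
    using lift_rel_class(1)[OF initial_lift_in_flag_lifts[OF B]] unfolding flag_subspace_def by blast
  have "underlying_subspace n (g i) \<subseteq> rspan n (set (take i B))"
    if "g = initial_lift n B \<or> g = reverse_odd n (initial_lift n B)" for g
    using that u underlying_reverse_orientation_subset[OF car] \<open>i < n\<close>
    by (auto simp: reverse_odd_def initial_lift_def split: if_splits)
  then show "flag_subspace n (lift_rel n `` {initial_lift n B}) i \<subseteq> rspan n (set (take i B))"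
    unfolding flag_subspace_def lift_rel_def by blast
qed

section \<open>The halfspace as a union of projective subspaces\<close>

text \<open>
  The coordinates of \<open>v\<close> lie in the span of the first \<open>k\<close> columns of a positive system. The
  flag spanned by all its columns is hyperconvex with the two given flags, because the
  oriented sums in question are initial minors of the system.
\<close>
lemma halfspace_vector_in_interval_flag:
  assumes E: "adapted_basis (2 * k) F1 F2 E" and v: "v \<in> carrier_vec (2 * k)" "v \<noteq> 0\<^sub>v (2 * k)"
    and S: "S_plus (2 * k) E v \<le> k - 1"
  shows "\<exists>F\<in>flag_interval (2 * k) F1 F2. v \<in> flag_subspace (2 * k) F k"
proof -
  define n where "n = 2 * k"
  have k: "0 < k" using v by (cases k) auto
  then have n: "0 < n" "k < n" by (auto simp: n_def)
  have Es: "E \<in> standard_orientation n" and F1: "F1 = lift_rel n `` {initial_lift n E}"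
    and F2: "F2 = lift_rel n `` {final_lift n E}"
    using E by (auto simp: adapted_basis_def n_def)
  have Ec: "length E = n" "set E \<subseteq> carrier_vec n" "0 < det (mat_of_cols n E)"
    using Es by (auto simp: mem_standard_orientation_iff)
  obtain c where c: "c \<in> carrier_vec n" "mat_of_cols n E *\<^sub>v c = v"
  proof -
    have "mat_of_cols n E \<in> carrier_mat n n" "det (mat_of_cols n E) \<noteq> 0" "v \<in> carrier_vec n"
      using Ec v by (auto simp: carrier_matI n_def)
    from mult_mat_vec_bij[OF this] show ?thesis using that by blast
  qed
  have "vec n (($) c) = c" using c(1) by auto
  then have "\<forall>\<sigma>\<in>{1, -1}. alternations \<sigma> (map (($) c) [0..<n]) \<le> k"
    using S_plus_le_iff[OF Es n(1), of "($) c" "k - 1"] S c(2) k by (simp add: n_def)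
  from positive_system_through_vector[OF this] obtain w d
    where w: "positive_system n n w" and d: "\<forall>i<n. c $ i = (\<Sum>j<k. d j * w j i)" by blast
  have "c = vec n (\<lambda>i. \<Sum>j<k. d j * w j i)" using d c(1) by auto
  then have v_eq: "v = mat_of_cols n (take k (frame n E w)) *\<^sub>v vec k d"
    using frame_combination[OF Ec(1), of k w d] n c(2) by simp
  have minor: "take i1 E @ take i2 (frame n E w) @ drop (i1 + i2) E \<in> standard_orientation n"
    if "i1 + i2 \<le> n" for i1 i2
    using w that frame_minor_iff[OF Es that] by (simp add: positive_system_def)
  let ?B = "frame n E w"
  have B: "?B \<in> standard_orientation n" using minor[of 0 n] Ec(1) by simp
  let ?F = "lift_rel n `` {initial_lift n ?B}"
  have "hyperconvex n F1 ?F F2"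
    unfolding hyperconvex_def
  proof (intro bexI allI impI)
    show "initial_lift n E \<in> F1" "initial_lift n ?B \<in> ?F" "final_lift n E \<in> F2"
      unfolding F1 F2
      by (rule lift_rel_class initial_lift_in_flag_lifts final_lift_in_flag_lifts Es B)+
    fix i1 i2 i3 assume i: "i1 < n" "i2 < n" "i3 < n" "i1 + i2 + i3 = n"
    then have "n - i3 = i1 + i2" by simp
    then show "oriented_sum n (oriented_sum n (initial_lift n E i1) (initial_lift n ?B i2)) (final_lift n E i3) = standard_orientation n"
      using oriented_sum_lifts_iff[OF Es B Es i(1-3)] minor[of i1 i2] i by simp
  qed
  then have "?F \<in> flag_interval n F1 F2"
    using lift_rel_class(2)[OF initial_lift_in_flag_lifts[OF B]] by (simp add: flag_interval_def)
  moreover have car: "set (take k ?B) \<subseteq> carrier_vec n"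
    using set_frame[OF Ec(1), of w] set_take_subset[of k ?B] by blast
  have "v \<in> rspan n (set (take k ?B))"
    unfolding rspan_eq[OF car] v_eq using n by (auto simp: min_def)
  then have "v \<in> flag_subspace n ?F k" using flag_subspace_class[OF B n(2)] by simp
  ultimately show ?thesis unfolding n_def by blast
qed

text \<open>
  Hyperconvexity with second dimension \<open>0\<close> is transversality of the two outer lifts and yields
  an adapted basis \<open>E\<close> for the very lifts that witness hyperconvexity; the remaining
  conditions then say that the coordinate columns of the middle flag form a positive system.
\<close>
lemma interval_flag_vector_in_halfspace:
  assumes F1: "F1 \<in> Flag_plus (2 * k)" and F2: "F2 \<in> Flag_plus (2 * k)"
    and F: "F \<in> flag_interval (2 * k) F1 F2"
    and v: "v \<in> flag_subspace (2 * k) F k" "v \<noteq> 0\<^sub>v (2 * k)"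
  shows "v \<in> carrier_vec (2 * k) \<and> (\<exists>E. adapted_basis (2 * k) F1 F2 E \<and> S_plus (2 * k) E v \<le> k - 1)"
proof -
  define n where "n = 2 * k"
  note F1 = F1[folded n_def] and F2 = F2[folded n_def] and F = F[folded n_def] and v = v[folded n_def]
  have Fp: "F \<in> Flag_plus n" and h: "hyperconvex n F1 F F2" using F by (auto simp: flag_interval_def)
  obtain f1 f f2 where f: "f1 \<in> F1" "f \<in> F" "f2 \<in> F2" and
    sum: "\<And>i1 i2 i3. \<lbrakk>i1 < n; i2 < n; i3 < n; i1 + i2 + i3 = n\<rbrakk> \<Longrightarrow>
      oriented_sum n (oriented_sum n (f1 i1) (f i2)) (f2 i3) = standard_orientation n"
    using h unfolding hyperconvex_def by blast
  \<comment> \<open>In dimension \<open>0\<close> a flag has no subspaces at all, hence contains no nonzero vector.\<close>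
  have k: "0 < k"
  proof (rule ccontr)
    assume "\<not> 0 < k"
    then have "n = 0" by (simp add: n_def)
    then have "flag_lifts n \<subseteq> {\<lambda>_. {}}" by (auto simp: flag_lifts_def)
    then have "F \<subseteq> {\<lambda>_. {}}" using Flag_plus_class(1)[OF Fp] by blast
    then have "v \<in> rspan n {}" using v(1) by (auto simp: flag_subspace_def underlying_subspace_def)
    then have "v \<in> carrier_vec n" using rspan_eq[of "[]" n] by (auto simp: carrier_matI intro!: mult_mat_vec_carrier[of _ n 0])
    then show False using v(2) \<open>n = 0\<close> by auto
  qed
  then have n: "0 < n" "k < n" by (auto simp: n_def)
  obtain P where P: "P \<in> standard_orientation n" "f1 = initial_lift n P"
    using flag_lift_eq_initial_lift[OF Flag_plus_class(1)[OF F1 f(1)]] by blast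
  obtain Q where Q: "Q \<in> standard_orientation n" "f2 = final_lift n Q"
    using flag_lift_eq_final_lift[OF Flag_plus_class(1)[OF F2 f(3)]] by blast
  obtain B where B: "B \<in> standard_orientation n" "f = initial_lift n B"
    using flag_lift_eq_initial_lift[OF Flag_plus_class(1)[OF Fp f(2)]] by blast
  have "take i P @ drop i Q \<in> standard_orientation n" if i: "1 \<le> i" "i < n" for i
    using sum[of i 0 "n - i"] oriented_sum_lifts_iff[OF P(1) B(1) Q(1), of i 0 "n - i"] P(2) B(2) Q(2) i by simp
  from adapted_basis_exists[OF P(1) Q(1) this] obtain E
    where Es: "E \<in> standard_orientation n" and E: "initial_lift n E = f1" "final_lift n E = f2"
    using P(2) Q(2) by blast
  have adapted: "adapted_basis n F1 F2 E"
    unfolding adapted_basis_def E using Es Flag_plus_class(2)[OF F1 f(1)] Flag_plus_class(2)[OF F2 f(3)] by blast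
  have Ec: "length E = n" using Es by (simp add: mem_standard_orientation_iff)
  obtain w where w: "B = frame n E w" using frame_exists[OF Es B(1)] by blast
  have "positive_system k n w"
    unfolding positive_system_def
  proof (intro allI impI, elim conjE)
    fix a m assume am: "m \<le> k" "a + m \<le> n"
    show "0 < initial_minor w a m"
    proof (cases "m = 0")
      case False
      then have i: "a < n" "m < n" "n - (a + m) < n" "a + m + (n - (a + m)) = n" "n - (n - (a + m)) = a + m"
        using am n by auto
      show ?thesis
        using sum[OF i(1-4)] oriented_sum_lifts_iff[OF Es B(1) Es i(1-3)] frame_minor_iff[OF Es am(2), of w] E B(2) w i(5)
        by simp
    qed simp
  qed
  have car: "set (take k B) \<subseteq> carrier_vec n"
    using B(1) set_take_subset[of k B] unfolding mem_standard_orientation_iff by blast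
  have "v \<in> rspan n (set (take k B))"
    using v(1) flag_subspace_class[OF B(1) n(2)] Flag_plus_class(2)[OF Fp f(2)] B(2) by simp
  then obtain c where c: "c \<in> carrier_vec k" "v = mat_of_cols n (take k B) *\<^sub>v c"
    unfolding rspan_eq[OF car] using w n by (auto simp: min_def)
  let ?u = "\<lambda>i. \<Sum>j<k. c $ j * w j i"
  have c_vec: "vec k (($) c) = c" using c(1) by auto
  have v_eq: "v = mat_of_cols n E *\<^sub>v vec n ?u"
    using frame_combination[OF Ec, of k w "($) c"] c(2) w n unfolding c_vec by simp
  have "\<exists>j<k. c $ j \<noteq> 0"
  proof (rule ccontr)
    assume "\<not> (\<exists>j<k. c $ j \<noteq> 0)"
    then have "?u = (\<lambda>_. 0)" by auto
    then have "v = mat_of_cols n E *\<^sub>v 0\<^sub>v n" using v_eq by (simp add: zero_vec_def)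
    also have "\<dots> = 0\<^sub>v n" using Ec by (auto intro!: eq_vecI)
    finally show False using v(2) by simp
  qed
  then have "\<forall>\<sigma>\<in>{1, -1}. alternations \<sigma> (map ?u [0..<n]) \<le> k"
    using alternations_combination_le[OF \<open>positive_system k n w\<close>, of "($) c"] by simp
  then have "S_plus n E v \<le> k - 1"
    unfolding v_eq S_plus_le_iff[OF Es n(1)] using k by simp
  moreover have "v \<in> carrier_vec n" unfolding v_eq by (rule mult_mat_vec_carrier[OF mat_of_cols_square[OF Ec]]) simp
  ultimately show ?thesis using adapted unfolding n_def by blast
qed

theorem proposition5p9:
  fixes n k :: nat and F1 F2 :: oriented_flag
  assumes "n = 2 * k"
    and "F1 \<in> Flag_plus n" and "F2 \<in> Flag_plus n"
    and "oriented_transverse n F1 F2"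
  shows "halfspace n F1 F2 =
    (\<Union>F\<in>flag_interval n F1 F2. projectivization n (flag_subspace n F k))"
proof
  show "halfspace n F1 F2 \<subseteq> (\<Union>F\<in>flag_interval n F1 F2. projectivization n (flag_subspace n F k))"
  proof
    fix p assume "p \<in> halfspace n F1 F2"
    then obtain v E where "p = proj_point v" "v \<in> carrier_vec n" "v \<noteq> 0\<^sub>v n"
      "adapted_basis n F1 F2 E" "S_plus n E v \<le> k - 1"
      using assms(1) unfolding halfspace_def by auto
    with halfspace_vector_in_interval_flag[of k F1 F2 E v] assms(1)
    show "p \<in> (\<Union>F\<in>flag_interval n F1 F2. projectivization n (flag_subspace n F k))"
      unfolding projectivization_def by blast
  qed
  show "(\<Union>F\<in>flag_interval n F1 F2. projectivization n (flag_subspace n F k)) \<subseteq> halfspace n F1 F2"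
  proof
    fix p assume "p \<in> (\<Union>F\<in>flag_interval n F1 F2. projectivization n (flag_subspace n F k))"
    then obtain F v where p: "p = proj_point v" and F: "F \<in> flag_interval n F1 F2"
      and v: "v \<in> flag_subspace n F k" "v \<noteq> 0\<^sub>v n"
      unfolding projectivization_def by blast
    from interval_flag_vector_in_halfspace[of F1 k F2 F v] F v assms(1-3) obtain E
      where "v \<in> carrier_vec n" "adapted_basis n F1 F2 E" "S_plus n E v \<le> n div 2 - 1" by auto
    then show "p \<in> halfspace n F1 F2" using p v(2) unfolding halfspace_def by blast
  qed
qed

end
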